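(* Let $I$ be a finite set of $N$ agents, let $0<a_{\min}\le a_{\max}$, and for every $(i,j)\in I\times I$ let $a_{ij}:[0,+\infty)\to\{0\}\cup[a_{\min},a_{\max}]$ be a measurable function, with $a_{ii}\equiv 0$. Assume that the topology is time-invariant, i.e. for every pair $(i,j)$ either $a_{ij}(t)=0$ for all $t\ge 0$ or $a_{ij}(t)\in[a_{\min},a_{\max}]$ for all $t\ge 0$, and let $\mathcal{G}_\infty=(I,\mathcal{E})$ be the directed graph with $(i,j)\in\mathcal{E}$ if and only if $a_{ij}(t)>0$ for all $t\ge 0$. Let $\Delta>0$ and let $q:\mathbb{R}\to\Delta\mathbb{Z}$ be the uniform quantizer $q(z)=\left\lfloor \frac{z}{\Delta}+\frac12\right\rfloor\Delta$. Let $x(t)=(x_i(t))_{i\in I}$ be a complete Krasovskii solution to $$\dot x_i=\sum_{j\in I}a_{ij}(t)\,\bigl(q(x_j)-q(x_i)\bigr),\qquad i\in I.$$ If the graph $\mathcal{T}(\mathcal{G}_\infty)$ of strongly connected components of $\mathcal{G}_\infty$ is connected and has only one sink, then there exist $T_{\mathrm{con}}\ge 0$ and $q_\infty\in\Delta\mathbb{Z}$ such that, for all $t\ge T_{\mathrm{con}}$, $$x_i(t)\in\left[q_\infty-\frac{\Delta}{2},\,q_\infty+\frac{\Delta}{2}\right]\qquad\text{for all } i\in I,$$ and the convergence time $T_{\mathrm{con}}$ satisfies $$T_{\mathrm{con}}\le\frac{1}{\Delta}\,\frac{N}{a_{\min}}\left(\frac{N\,a_{\max}}{a_{\min}}\right)^{N}\max_{i,j\in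 I}\bigl|q(x_i(0))-q(x_j(0))\bigr|.$$
   Context: Krasovskii operator: for $f:\mathbb{R}^n\to\mathbb{R}^m$, $\mathcal{K}f(x)=\bigcap_{\delta>0}\overline{\mathrm{co}}\,f(B(x,\delta))$, where $\overline{\mathrm{co}}$ is the closed convex hull and $B(x,\delta)$ the Euclidean ball of radius $\delta$ centered at $x$. For a time-dependent $f(t,x)$ the operator acts on the $x$ variable only: $\mathcal{K}f(t,x)=\bigcap_{\delta>0}\overline{\mathrm{co}}\,f(t,B(x,\delta))$. Krasovskii solution: an absolutely continuous function $x(\cdot)$ on an interval $J$ satisfying $\dot x(t)\in\mathcal{K}f(t,x(t))$ for almost every (Lebesgue) $t\in J$. For the system in the claim this means $\dot x(t)\in -L(t)\,\mathcal{K}q(x(t))$ for almost every $t$, where $L(t)$ is the Laplacian matrix ($L_{ij}(t)=-a_{ij}(t)$ for $i\ne j$, $L_{ii}(t)=\sum_{j}a_{ij}(t)$) and $q$ acts componentwise on vectors; equivalently, for almost every $t$ there are $z_k\in\mathcal{K}q(x_k(t))$, $k\in I$, such that $\dot x_i(t)=\sum_{j}a_{ij}(t)(z_j-z_i)$ for all $i\in I$. A solution is complete if it is defined for all positive times (extended continuously to $t=0$, with initial condition $x(0)$). Graph notions: in a directed graph, $v$ can be reached from $u$ if there is a directed path $(u,w_1),(w_1,w_2),\dots,(w_{l-1},v)$ of edges. A graph is connected if for every pair of nodes $(u,v)$ either $v$ can be reached from $u$ or $u$ can be reached from $v$; it is strongly connected if every two nodes can be reached from each other. A sink is a node with no outgoing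 edge. For a directed graph $G=(V,E)$ with strongly connected components having vertex sets $V_1,\dots,V_s$ (a partition of $V$), $\mathcal{T}(G)$ is the directed graph with vertex set $\{1,\dots,s\}$ having an arc from $h$ to $k$ ($h\neq k$) if $G$ has an arc from a vertex in $V_h$ to a vertex in $V_k$. $\Delta\mathbb{Z}$ denotes the set of integer multiples of $\Delta$. *)

theory Defs
  imports "HOL-Analysis.Analysis" "Graph_Theory.Digraph_Component"
begin

section \<open>Krasovskii solutions\<close>

definition krasovskii :: "('a::metric_space \<Rightarrow> 'b::real_normed_vector) \<Rightarrow> 'a \<Rightarrow> 'b set" where
  "krasovskii f x = (\<Inter>\<delta>\<in>{0<..}. closure (convex hull (f ` ball x \<delta>)))"

text \<open>
  The constant \<^const>\<open>absolutely_continuous\<close> of HOL-Analysis is the relation between measures;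
  the notion for functions of a real variable is not available. The pairs in \<open>D\<close> are the
  endpoints of finitely many non-overlapping intervals in \<open>S\<close>.
\<close>

definition absolutely_continuous_on :: "real set \<Rightarrow> (real \<Rightarrow> 'a::real_normed_vector) \<Rightarrow> bool" where
  "absolutely_continuous_on S f \<longleftrightarrow>
    (\<forall>\<epsilon>>0. \<exists>\<delta>>0. \<forall>D :: (real \<times> real) set.
      finite D \<and> (\<forall>(u, v)\<in>D. u < v \<and> {u..v} \<subseteq> S) \<and>
      pairwise (\<lambda>(u, v) (u', v'). {u<..<v} \<inter> {u'<..<v'} = {}) D \<and>
      (\<Sum>(u, v)\<in>D. v - u) < \<delta> \<longrightarrow>
      (\<Sum>(u, v)\<in>D. norm (f v - f u)) < \<epsilon>)"

text \<open>
  Solutions live on a possibly unbounded or open interval \<open>J\<close>, so absolute continuity is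
  required, as usual, on the compact subintervals of \<open>J\<close>.
\<close>

definition krasovskii_solution ::
    "real set \<Rightarrow> (real \<Rightarrow> 'a::real_normed_vector \<Rightarrow> 'a) \<Rightarrow> (real \<Rightarrow> 'a) \<Rightarrow> bool" where
  "krasovskii_solution J f x \<longleftrightarrow>
    (\<forall>c d. {c..d} \<subseteq> J \<longrightarrow> absolutely_continuous_on {c..d} x) \<and>
    (AE t\<in>J in lebesgue.
      \<exists>v. (x has_vector_derivative v) (at t within J) \<and> v \<in> krasovskii (f t) (x t))"

definition complete_krasovskii_solution ::
    "(real \<Rightarrow> 'a::real_normed_vector \<Rightarrow> 'a) \<Rightarrow> (real \<Rightarrow> 'a) \<Rightarrow> bool" where
  "complete_krasovskii_solution f x \<longleftrightarrow>
    krasovskii_solution {0<..} f x \<and> continuous (at_right 0) x"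


section \<open>Quantized consensus dynamics\<close>

definition multiples :: "real \<Rightarrow> real set" where
  "multiples \<Delta> = range (\<lambda>k::int. of_int k * \<Delta>)"

definition uniform_quantizer :: "real \<Rightarrow> real \<Rightarrow> real" where
  "uniform_quantizer \<Delta> z = of_int \<lfloor>z / \<Delta> + 1 / 2\<rfloor> * \<Delta>"

definition quantized_consensus ::
    "('n \<Rightarrow> 'n \<Rightarrow> real \<Rightarrow> real) \<Rightarrow> (real \<Rightarrow> real) \<Rightarrow> real \<Rightarrow> real ^ 'n \<Rightarrow> real ^ 'n::finite" where
  "quantized_consensus a q t y = (\<chi> i. \<Sum>j\<in>UNIV. a i j t * (q (y $ j) - q (y $ i)))"


section \<open>Graph of strongly connected components\<close>

text \<open>
  The library's \<^const>\<open>Digraph_Component.connected\<close> ignores the direction of the arcs; the notion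
  needed here does not. \<^const>\<open>reachable\<close> is reflexive on the vertices.
\<close>

definition unilaterally_connected :: "('a, 'b) pre_digraph \<Rightarrow> bool" where
  "unilaterally_connected G \<longleftrightarrow>
    (\<forall>u\<in>verts G. \<forall>v\<in>verts G. u \<rightarrow>\<^sup>*\<^bsub>G\<^esub> v \<or> v \<rightarrow>\<^sup>*\<^bsub>G\<^esub> u)"

definition is_sink :: "('a, 'b) pre_digraph \<Rightarrow> 'a \<Rightarrow> bool" where
  "is_sink G v \<longleftrightarrow> v \<in> verts G \<and> out_arcs G v = {}"

text \<open>The vertices are the vertex sets of the components themselves, instead of indices.\<close>

definition condensation :: "('a, 'b) pre_digraph \<Rightarrow> 'a set pair_pre_digraph" where
  "condensation G =
    \<lparr> pverts = verts ` pre_digraph.sccs G,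
      parcs = {(V, W). V \<in> verts ` pre_digraph.sccs G \<and> W \<in> verts ` pre_digraph.sccs G \<and>
                       V \<noteq> W \<and> (\<exists>v\<in>V. \<exists>w\<in>W. v \<rightarrow>\<^bsub>G\<^esub> w)} \<rparr>"

definition limit_graph :: "('n \<Rightarrow> 'n \<Rightarrow> real \<Rightarrow> real) \<Rightarrow> 'n pair_pre_digraph" where
  "limit_graph a = \<lparr> pverts = UNIV, parcs = {(i, j). \<forall>t\<ge>0. a i j t > 0} \<rparr>"

end

theory Submission
  imports Defs
begin

text \<open>
  Measured in units of \<open>\<Delta>\<close>, the quantizer rounds to the nearest integer, and at almost every time the
  solution satisfies \<open>x\<^sub>i' = (\<Sum>j. a\<^sub>i\<^sub>j (z\<^sub>j - z\<^sub>i))\<close> with \<open>z\<^sub>k\<close> in the Krasovskii value of the quantizer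
  at \<open>x\<^sub>k\<close> (lemma \<open>krasovskii_quantized_consensus\<close>). The value is monotone in \<open>x\<^sub>k\<close> away from the jumps, and at
  almost every time an agent that sits on a jump has velocity zero. Hence the maximum over a set of
  agents closed under outgoing edges never increases and the minimum never decreases
  (lemmas \<open>upper_bound_invariant\<close> and \<open>lower_bound_invariant\<close>).

  Suppose that all agents lie in \<open>[l - 1/2, h + 1/2]\<close> with integers \<open>l < h\<close>. The claim is that after a
  time bounded by the per-level constant of the theorem, either nobody is above \<open>h - 1/2\<close> or nobody is
  below \<open>l + 1/2\<close>; induction on \<open>h - l\<close> then gives the theorem. Let \<open>r\<close> be an agent that can be reached
  from every agent; it exists in the sink component. As \<open>h - l \<ge> 1\<close>, at every time \<open>z\<^sub>r \<le> h - 1/2\<close> or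
  \<open>z\<^sub>r \<ge> l + 1/2\<close>. In the first case the deficit \<open>h - z\<^sub>r \<ge> 1/2\<close> travels backwards along the edges: an agent
  resting on the threshold \<open>h - 1/2\<close> has zero velocity, so its deficit is a weighted mean of those of its
  neighbours and is at least \<open>\<kappa> = a_min / (N a_max)\<close> times any of them, while below the threshold
  the deficit is at least 1. So some agent above the threshold feels a deficit and descends at a speed of
  at least \<open>a_min \<kappa>^(N-2) / 2\<close> (lemma \<open>upper_velocity_decay\<close>). In the second case some agent below
  \<open>l + 1/2\<close> rises at that speed, by the symmetry \<open>x \<mapsto> -x\<close>. The total distance of the agents in the two
  extreme levels from the inner thresholds is at most \<open>N\<close>, so one of the two levels is empty after the time
  \<open>N\<close> divided by the speed.

  The boundary of the interval needs care: an agent at exactly \<open>h + 1/2\<close> may have \<open>z > h\<close> and lift others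
  above \<open>h - 1/2\<close>. By a maximum principle (lemma \<open>selection_le_level\<close>) this happens only when everything
  reachable from \<open>r\<close> sits at \<open>h + 1/2\<close>. There it remains for ever, the second case holds from then on, and
  the lower level empties within one more such time. Looking at the state after the first period decides which of
  the two arguments to use (lemma \<open>spread_decreases\<close>). The factor two is absorbed by \<open>\<kappa> \<le> 1/2\<close>, valid for
  \<open>N \<ge> 2\<close>.
\<close>

section \<open>Growth of absolutely continuous functions\<close>

text \<open>
  An upper bound for the slopes of chords that straddle the point. It follows from a derivative bound but
  also makes sense for a maximum of several functions, which need not be differentiable.
\<close>

definition secant_bound :: "(real \<Rightarrow> real) \<Rightarrow> real \<Rightarrow> real \<Rightarrow> bool" where
  "secant_bound f c t \<longleftrightarrow>
    (\<forall>\<eta>>0. \<exists>\<delta>>0. \<forall>u v. u \<in> ball t \<delta> \<and> v \<in> ball t \<delta> \<and> u \<le> t \<and> t \<le> v \<longrightarrow>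
      f v - f u \<le> (c + \<eta>) * (v - u))"

lemma secant_bound_if_derivative:
  assumes "(f has_real_derivative d) (at t)" and "d \<le> c"
  shows "secant_bound f c t"
  unfolding secant_bound_def
proof (intro allI impI)
  fix \<eta> :: real assume "0 < \<eta>"
  have "(f has_derivative (\<lambda>h. d * h)) (at t)"
    using assms(1) by (simp add: has_field_derivative_def)
  then obtain \<delta> where \<delta>: "0 < \<delta>"
    "\<And>y. \<bar>y - t\<bar> < \<delta> \<Longrightarrow> \<bar>f y - f t - d * (y - t)\<bar> \<le> \<eta> * \<bar>y - t\<bar>"
    using \<open>0 < \<eta>\<close> unfolding has_derivative_at_alt real_norm_def by meson
  have "f v - f u \<le> (c + \<eta>) * (v - u)"
    if "u \<in> ball t \<delta>" "v \<in> ball t \<delta>" "u \<le> t" "t \<le> v" for u v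
  proof -
    have "f v - f u \<le> d * (v - u) + \<eta> * (v - u)"
      using \<delta>(2)[of u] \<delta>(2)[of v] that by (auto simp: dist_real_def algebra_simps abs_le_iff)
    also have "\<dots> \<le> c * (v - u) + \<eta> * (v - u)"
      using assms(2) that by (intro add_right_mono mult_right_mono) auto
    finally show ?thesis by (simp add: algebra_simps)
  qed
  then show "\<exists>\<delta>>0. \<forall>u v. u \<in> ball t \<delta> \<and> v \<in> ball t \<delta> \<and> u \<le> t \<and> t \<le> v \<longrightarrow>
      f v - f u \<le> (c + \<eta>) * (v - u)"
    using \<delta>(1) by blast
qed

text \<open>
  Covers components, multiples, sums, positive parts and maxima of absolutely continuous functions alike.
\<close>

lemma absolutely_continuous_on_dominated:
  fixes g :: "'i \<Rightarrow> real \<Rightarrow> 'a::real_normed_vector" and f :: "real \<Rightarrow> 'b::real_normed_vector"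
  assumes fin: "finite I" and ac: "\<And>i. i \<in> I \<Longrightarrow> absolutely_continuous_on S (g i)"
    and dom: "\<And>u v. u \<in> S \<Longrightarrow> v \<in> S \<Longrightarrow> norm (f v - f u) \<le> C * (\<Sum>i\<in>I. norm (g i v - g i u))"
  shows "absolutely_continuous_on S f"
  unfolding absolutely_continuous_on_def
proof (intro allI impI)
  fix \<epsilon> :: real assume "0 < \<epsilon>"
  define K where "K = (\<bar>C\<bar> + 1) * (real (card I) + 1)"
  have "0 < K" unfolding K_def by (intro mult_pos_pos add_nonneg_pos) auto
  define ok where "ok i \<delta> \<longleftrightarrow> 0 < \<delta> \<and> (\<forall>D :: (real \<times> real) set.
      finite D \<and> (\<forall>(u, v)\<in>D. u < v \<and> {u..v} \<subseteq> S) \<and>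
      pairwise (\<lambda>(u, v) (u', v'). {u<..<v} \<inter> {u'<..<v'} = {}) D \<and>
      (\<Sum>(u, v)\<in>D. v - u) < \<delta> \<longrightarrow> (\<Sum>(u, v)\<in>D. norm (g i v - g i u)) < \<epsilon> / K)" for i \<delta>
  have "\<exists>\<delta>. ok i \<delta>" if "i \<in> I" for i
    unfolding ok_def using ac[OF that, unfolded absolutely_continuous_on_def, THEN spec, THEN mp,
        OF divide_pos_pos[OF \<open>0 < \<epsilon>\<close> \<open>0 < K\<close>]] .
  then obtain d where ok: "\<And>i. i \<in> I \<Longrightarrow> ok i (d i)" by metis
  have d: "\<And>i. i \<in> I \<Longrightarrow> d i > 0" using ok by (simp add: ok_def)
  define \<delta> where "\<delta> = Min (insert 1 (d ` I))"
  have "0 < \<delta>" and \<delta>_le: "\<And>i. i \<in> I \<Longrightarrow> \<delta> \<le> d i"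
    unfolding \<delta>_def using fin d by auto
  have "(\<Sum>(u, v)\<in>D. norm (f v - f u)) < \<epsilon>"
    if D: "finite D \<and> (\<forall>(u, v)\<in>D. u < v \<and> {u..v} \<subseteq> S) \<and>
      pairwise (\<lambda>(u, v) (u', v'). {u<..<v} \<inter> {u'<..<v'} = {}) D \<and>
      (\<Sum>(u, v)\<in>D. v - u) < \<delta>" for D :: "(real \<times> real) set"
  proof -
    have 1: "(\<Sum>(u, v)\<in>D. norm (g i v - g i u)) \<le> \<epsilon> / K" if "i \<in> I" for i
    proof -
      have "(\<Sum>(u, v)\<in>D. v - u) < d i" using D \<delta>_le[OF that] by linarith
      then show ?thesis using ok[OF that] D unfolding ok_def by (meson less_imp_le)
    qed
    have "(\<Sum>(u, v)\<in>D. norm (f v - f u)) \<le> (\<Sum>(u, v)\<in>D. C * (\<Sum>i\<in>I. norm (g i v - g i u)))"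
    proof (intro sum_mono, clarify)
      fix u v assume "(u, v) \<in> D"
      then have "u < v" "{u..v} \<subseteq> S" using D by auto
      then show "norm (f v - f u) \<le> C * (\<Sum>i\<in>I. norm (g i v - g i u))" by (intro dom) auto
    qed
    also have "\<dots> = C * (\<Sum>i\<in>I. \<Sum>(u, v)\<in>D. norm (g i v - g i u))"
      by (subst sum.swap) (simp add: sum_distrib_left case_prod_unfold)
    also have "\<dots> \<le> \<bar>C\<bar> * (\<Sum>i\<in>I. \<Sum>(u, v)\<in>D. norm (g i v - g i u))"
      by (intro mult_right_mono sum_nonneg) auto
    also have "\<dots> \<le> \<bar>C\<bar> * (\<Sum>i\<in>I. \<epsilon> / K)"
      using 1 by (intro mult_left_mono sum_mono) auto
    also have "\<dots> = \<bar>C\<bar> * real (card I) * (\<epsilon> / K)" by simp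
    also have "\<dots> < K * (\<epsilon> / K)"
    proof (rule mult_strict_right_mono)
      have "K = \<bar>C\<bar> * real (card I) + \<bar>C\<bar> + real (card I) + 1"
        unfolding K_def by (simp add: algebra_simps)
      then show "\<bar>C\<bar> * real (card I) < K" by linarith
    qed (use \<open>0 < \<epsilon>\<close> \<open>0 < K\<close> in simp)
    finally show ?thesis using \<open>0 < K\<close> by simp
  qed
  then show "\<exists>\<delta>>0. \<forall>D :: (real \<times> real) set.
      finite D \<and> (\<forall>(u, v)\<in>D. u < v \<and> {u..v} \<subseteq> S) \<and>
      pairwise (\<lambda>(u, v) (u', v'). {u<..<v} \<inter> {u'<..<v'} = {}) D \<and>
      (\<Sum>(u, v)\<in>D. v - u) < \<delta> \<longrightarrow> (\<Sum>(u, v)\<in>D. norm (f v - f u)) < \<epsilon>"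
    using \<open>0 < \<delta>\<close> by blast
qed

text \<open>
  The mean value inequality for absolutely continuous functions. In a sufficiently fine tagged division,
  the intervals tagged outside the exceptional null set \<open>N\<close> obey the slope bound, and those tagged inside
  \<open>N\<close> lie in an open set of tiny measure, so that absolute continuity makes their contribution small.
\<close>

lemma absolutely_continuous_growth_bound:
  fixes f :: "real \<Rightarrow> real"
  assumes "a \<le> b" and ac: "absolutely_continuous_on {a..b} f"
    and sec: "AE t in lebesgue. a < t \<longrightarrow> t < b \<longrightarrow> secant_bound f c t"
  shows "f b - f a \<le> c * (b - a)"
proof (rule field_le_epsilon)
  fix e :: real assume "0 < e"
  define \<eta> where "\<eta> = e / 2 / (b - a + 1)"
  have "0 < \<eta>" "\<eta> * (b - a) \<le> e / 2"
    unfolding \<eta>_def using \<open>0 < e\<close> \<open>a \<le> b\<close> by (auto simp: field_simps)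
  obtain N0 where N0: "N0 \<in> null_sets lebesgue"
    "{t. \<not> (a < t \<longrightarrow> t < b \<longrightarrow> secant_bound f c t)} \<subseteq> N0"
    using sec by (auto simp: eventually_ae_filter)
  define N where "N = insert a (insert b N0)"
  have N: "N \<in> null_sets lebesgue"
  proof -
    have "{a, b} \<in> null_sets lebesgue"
      by (intro null_sets_completionI countable_imp_null_set_lborel) auto
    then have "{a, b} \<union> N0 \<in> null_sets lebesgue" using N0(1) by (rule null_sets.Un)
    then show ?thesis by (simp add: N_def)
  qed
  have slope: "\<exists>d>0. \<forall>u v. u \<in> ball t d \<and> v \<in> ball t d \<and> u \<le> t \<and> t \<le> v \<longrightarrow>
      f v - f u \<le> (c + \<eta>) * (v - u)" if "t \<in> {a..b} - N" for t
    using that N0(2) \<open>0 < \<eta>\<close> unfolding N_def secant_bound_def by force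
  then obtain d where d: "\<And>t. t \<in> {a..b} - N \<Longrightarrow> d t > 0"
    "\<And>t u v. t \<in> {a..b} - N \<Longrightarrow> u \<in> ball t (d t) \<Longrightarrow> v \<in> ball t (d t) \<Longrightarrow> u \<le> t \<Longrightarrow> t \<le> v
      \<Longrightarrow> f v - f u \<le> (c + \<eta>) * (v - u)"
    by metis
  have "0 < e / 4" using \<open>0 < e\<close> by simp
  then obtain \<delta> where "0 < \<delta>" and \<delta>: "\<forall>D :: (real \<times> real) set.
      finite D \<and> (\<forall>(u, v)\<in>D. u < v \<and> {u..v} \<subseteq> {a..b}) \<and>
      pairwise (\<lambda>(u, v) (u', v'). {u<..<v} \<inter> {u'<..<v'} = {}) D \<and>
      (\<Sum>(u, v)\<in>D. v - u) < \<delta> \<longrightarrow> (\<Sum>(u, v)\<in>D. norm (f v - f u)) < e / 4"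
    by (rule ac[unfolded absolutely_continuous_on_def, THEN spec, THEN mp, THEN exE])
      (elim conjE)
  define k where "k = \<bar>c + \<eta>\<bar> + 1"
  have "0 < k" "\<bar>c + \<eta>\<bar> \<le> k" unfolding k_def by auto
  define \<delta>' where "\<delta>' = min \<delta> (e / (4 * k))"
  have "0 < \<delta>'" "\<delta>' \<le> \<delta>"
    using \<open>0 < \<delta>\<close> \<open>0 < e\<close> \<open>0 < k\<close> unfolding \<delta>'_def by auto
  have \<delta>'c: "\<bar>c + \<eta>\<bar> * \<delta>' \<le> e / 4"
  proof -
    have "\<bar>c + \<eta>\<bar> * \<delta>' \<le> k * (e / (4 * k))"
      using \<open>0 < \<delta>'\<close> \<open>\<bar>c + \<eta>\<bar> \<le> k\<close> \<open>0 < k\<close> unfolding \<delta>'_def by (intro mult_mono) auto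
    also have "\<dots> = e / 4" using \<open>0 < k\<close> by simp
    finally show ?thesis .
  qed
  obtain T where T: "open T" "N \<subseteq> T" "T - N \<in> lmeasurable" "emeasure lebesgue (T - N) < ennreal \<delta>'"
    using sets_lebesgue_outer_open[of N \<delta>'] N \<open>0 < \<delta>'\<close> by (auto simp: null_sets_def)
  have eT: "emeasure lebesgue T < ennreal \<delta>'"
  proof -
    have "emeasure lebesgue T \<le> emeasure lebesgue (T - N) + emeasure lebesgue N"
      using T N by (metis Diff_partition Un_commute emeasure_subadditive fmeasurableD null_setsD2)
    then show ?thesis using T(4) N by (simp add: null_sets_def)
  qed
  have Tm: "T \<in> lmeasurable"
    using eT T(1) by (intro fmeasurableI) (auto simp: less_top[symmetric] intro: order.strict_trans)
  have mT: "measure lebesgue T < \<delta>'"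
    using eT Tm \<open>0 < \<delta>'\<close> by (simp add: emeasure_eq_measure2 ennreal_less_iff)
  \<comment> \<open>Intervals tagged in the null set stay in \<open>T\<close>, which bounds their total length.\<close>
  define \<gamma> where "\<gamma> t = (if t \<in> N then T else if t \<in> {a..b} then ball t (d t) else UNIV)" for t
  have "gauge \<gamma>"
    using T d(1) unfolding gauge_def \<gamma>_def by auto
  then obtain p where p: "p tagged_division_of {a..b}" "\<gamma> fine p"
    using fine_division_exists_real by blast
  note pD = tagged_division_ofD[OF p(1)]
  have iv: "Inf K \<le> t \<and> t \<le> Sup K \<and> K = {Inf K..Sup K} \<and> Inf K \<in> K \<and> Sup K \<in> K \<and> K \<subseteq> \<gamma> t \<and> K \<subseteq> {a..b} \<and> t \<in> {a..b}"
    if tK: "(t, K) \<in> p" for t K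
  proof -
    obtain l m where K: "K = cbox l m" using pD(4)[OF tK] by blast
    moreover have "t \<in> K" using pD(2)[OF tK] .
    ultimately have "l \<le> m" "K = {l..m}" by auto
    then have "Inf K = l" "Sup K = m" by auto
    then show ?thesis using \<open>t \<in> K\<close> \<open>K = {l..m}\<close> \<open>l \<le> m\<close> pD(3)[OF tK] p(2) tK
      unfolding fine_def by force
  qed
  \<comment> \<open>Degenerate intervals are left out: they contribute nothing, and absolute continuity is about proper ones.\<close>
  define p1 where "p1 = {(t, K)\<in>p. t \<in> N \<and> Inf K < Sup K}"
  define D where "D = (\<lambda>(t, K). (Inf K, Sup K)) ` p1"
  have fin: "finite p" using pD(1) .
  have fin1: "p1 \<subseteq> p" "finite p1"
  proof -
    show "p1 \<subseteq> p" unfolding p1_def by auto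
    then show "finite p1" using fin by (rule finite_subset)
  qed
  have disj: "{Inf K1<..<Sup K1} \<inter> {Inf K2<..<Sup K2} = {}"
    if "(t1, K1) \<in> p" "(t2, K2) \<in> p" "(t1, K1) \<noteq> (t2, K2)" for t1 t2 K1 K2
    using pD(5)[OF that] iv[OF that(1)] iv[OF that(2)] by (metis interior_atLeastAtMost_real)
  have inj: "inj_on (\<lambda>(t, K). (Inf K, Sup K)) p1"
  proof (rule inj_onI, clarify)
    fix t1 K1 t2 K2 assume *: "(t1, K1) \<in> p1" "(t2, K2) \<in> p1" "Inf K1 = Inf K2" "Sup K1 = Sup K2"
    show "t1 = t2 \<and> K1 = K2"
    proof (rule ccontr)
      assume "\<not> (t1 = t2 \<and> K1 = K2)"
      then have "{Inf K1<..<Sup K1} = {}"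
        using disj[of t1 K1 t2 K2] * fin1(1) by auto
      then show False using *(1) unfolding p1_def by auto
    qed
  qed
  have D_sum: "(\<Sum>(u, v)\<in>D. h u v) = (\<Sum>(t, K)\<in>p1. h (Inf K) (Sup K))" for h :: "real \<Rightarrow> real \<Rightarrow> real"
    unfolding D_def by (subst sum.reindex[OF inj]) (simp add: case_prod_unfold)
  have len: "(\<Sum>(t, K)\<in>p1. Sup K - Inf K) < \<delta>'"
  proof -
    have "(\<Sum>(t, K)\<in>p1. Sup K - Inf K) = (\<Sum>y\<in>p1. measure lebesgue {Inf (snd y)<..<Sup (snd y)})"
      by (intro sum.cong) (auto simp: p1_def)
    also have "\<dots> = measure lebesgue (\<Union>y\<in>p1. {Inf (snd y)<..<Sup (snd y)})"
    proof (rule measure_finite_Union[symmetric])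
      show "disjoint_family_on (\<lambda>y. {Inf (snd y)<..<Sup (snd y)}) p1"
        unfolding disjoint_family_on_def using disj fin1(1) by (metis prod.collapse subsetD)
      show "emeasure lebesgue {Inf (snd y)<..<Sup (snd y)} \<noteq> \<infinity>" if "y \<in> p1" for y
        using that by (cases y) (simp add: p1_def)
    qed (use fin1 in auto)
    also have "\<dots> \<le> measure lebesgue T"
    proof (rule measure_mono_fmeasurable[OF _ _ Tm])
      show "(\<Union>y\<in>p1. {Inf (snd y)<..<Sup (snd y)}) \<subseteq> T"
      proof clarify
        fix t K s assume "(t, K) \<in> p1" "s \<in> {Inf (snd (t, K))<..<Sup (snd (t, K))}"
        moreover from this have "(t, K) \<in> p" "t \<in> N" by (auto simp: p1_def)
        ultimately show "s \<in> T" using iv[of t K] by (auto simp: \<gamma>_def)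
      qed
    qed (use fin1 in auto)
    finally show ?thesis using mT by simp
  qed
  have b1: "(\<Sum>(t, K)\<in>p1. \<bar>f (Sup K) - f (Inf K)\<bar>) < e / 4"
  proof -
    have "(\<Sum>(u, v)\<in>D. norm (f v - f u)) < e / 4"
    proof (rule \<delta>[THEN spec, THEN mp], intro conjI)
      show "finite D" unfolding D_def using fin1 by simp
      show "\<forall>(u, v)\<in>D. u < v \<and> {u..v} \<subseteq> {a..b}"
        using iv unfolding D_def p1_def by fastforce
      show "pairwise (\<lambda>(u, v) (u', v'). {u<..<v} \<inter> {u'<..<v'} = {}) D"
        unfolding pairwise_def D_def using disj fin1(1) by fastforce
      show "(\<Sum>(u, v)\<in>D. v - u) < \<delta>"
        unfolding D_sum[of "\<lambda>u v. v - u"] using len \<open>\<delta>' \<le> \<delta>\<close> by simp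
    qed
    then show ?thesis unfolding D_sum[of "\<lambda>u v. norm (f v - f u)"] by simp
  qed
  define F where "F = (\<lambda>(t :: real, K). f (Sup K) - f (Inf K) - (c + \<eta>) * (Sup K - Inf K))"
  have tele: "sum F p = f b - f a - (c + \<eta>) * (b - a)"
  proof -
    have "(\<Sum>(t, K)\<in>p. f (Sup K) - f (Inf K)) = f b - f a"
      by (rule additive_tagged_division_1[OF \<open>a \<le> b\<close> p(1)])
    moreover have "(\<Sum>(t, K)\<in>p. Sup K - Inf K) = b - a"
      using additive_tagged_division_1[OF \<open>a \<le> b\<close> p(1), of "\<lambda>x. x"] by simp
    ultimately show ?thesis
      unfolding F_def by (simp add: case_prod_unfold sum_subtractf flip: sum_distrib_left)
  qed
  have "sum F p = sum F (p - p1) + sum F p1"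
    using fin fin1 by (simp add: sum.subset_diff)
  also have "sum F (p - p1) \<le> 0"
  proof (rule sum_nonpos, clarify)
    fix t K assume tK: "(t, K) \<in> p" "(t, K) \<notin> p1"
    show "F (t, K) \<le> 0"
    proof (cases "t \<in> N")
      case True
      then have "Sup K = Inf K" using tK iv[OF tK(1)] by (auto simp: p1_def)
      then show ?thesis by (simp add: F_def)
    next
      case False
      then have "f (Sup K) - f (Inf K) \<le> (c + \<eta>) * (Sup K - Inf K)"
        using iv[OF tK(1)] by (intro d(2)[of t]) (auto simp: \<gamma>_def)
      then show ?thesis by (simp add: F_def)
    qed
  qed
  also have "sum F p1 \<le> (\<Sum>(t, K)\<in>p1. \<bar>f (Sup K) - f (Inf K)\<bar> + \<bar>c + \<eta>\<bar> * (Sup K - Inf K))"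
  proof (intro sum_mono, clarify)
    fix t K assume "(t, K) \<in> p1"
    then have "Inf K < Sup K" by (simp add: p1_def)
    then have "- ((c + \<eta>) * (Sup K - Inf K)) \<le> \<bar>c + \<eta>\<bar> * (Sup K - Inf K)"
      by (metis abs_ge_minus_self diff_ge_0_iff_ge less_imp_le mult_minus_left mult_right_mono)
    then show "F (t, K) \<le> \<bar>f (Sup K) - f (Inf K)\<bar> + \<bar>c + \<eta>\<bar> * (Sup K - Inf K)"
      unfolding F_def by auto
  qed
  also have "\<dots> = (\<Sum>(t, K)\<in>p1. \<bar>f (Sup K) - f (Inf K)\<bar>) + \<bar>c + \<eta>\<bar> * (\<Sum>(t, K)\<in>p1. Sup K - Inf K)"
    by (simp add: case_prod_unfold sum.distrib sum_distrib_left)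
  also have "\<dots> \<le> e / 4 + \<bar>c + \<eta>\<bar> * \<delta>'"
    using b1 len by (intro add_mono mult_left_mono) auto
  finally have "sum F p \<le> e / 2" using \<delta>'c by simp
  then show "f b - f a \<le> c * (b - a) + e"
    using tele \<open>\<eta> * (b - a) \<le> e / 2\<close> by (simp add: algebra_simps)
qed

text \<open>
  A basic open set that meets \<open>S\<close> in one point only determines that point.
\<close>

lemma countable_if_isolated:
  fixes S :: "'a::second_countable_topology set"
  assumes "\<And>p. p \<in> S \<Longrightarrow> \<exists>U. open U \<and> S \<inter> U = {p}"
  shows "countable S"
proof -
  obtain B :: "'a set set" where B: "countable B" "topological_basis B"
    using ex_countable_basis by blast
  have "\<exists>b\<in>B. S \<inter> b = {p}" if p: "p \<in> S" for p
  proof -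
    obtain U where U: "open U" "S \<inter> U = {p}" using assms[OF p] by blast
    then have "p \<in> U" by auto
    then obtain b where "b \<in> B" "p \<in> b" "b \<subseteq> U"
      using topological_basisE[OF B(2) U(1)] by blast
    then show ?thesis using U p by blast
  qed
  then obtain h where h: "\<And>p. p \<in> S \<Longrightarrow> h p \<in> B \<and> S \<inter> h p = {p}" by metis
  then have "inj_on h S" by (metis inj_onI singleton_inject)
  moreover have "h ` S \<subseteq> B" using h by auto
  ultimately show ?thesis using B(1) by (metis countable_image_inj_on countable_subset)
qed

text \<open>
  A function that crosses a level with nonzero speed does not take the level again nearby. Therefore, almost
  everywhere on a level set, a derivative that exists vanishes.
\<close>

lemma countable_transversal_level:
  fixes f :: "real \<Rightarrow> real"
  shows "countable {t. f t = c \<and> (\<exists>d. d \<noteq> 0 \<and> (f has_real_derivative d) (at t))}" (is "countable ?S")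
proof (rule countable_if_isolated)
  fix p assume "p \<in> ?S"
  then obtain d where d: "f p = c" "d \<noteq> 0" "(f has_real_derivative d) (at p)" by auto
  have "((\<lambda>y. (f y - f p) / (y - p)) \<longlongrightarrow> d) (at p)"
    using d(3) by (simp add: has_field_derivative_iff)
  then have "\<forall>\<^sub>F y in at p. (f y - f p) / (y - p) \<noteq> 0"
    using d(2) by (rule tendsto_imp_eventually_ne)
  then obtain U where U: "open U" "p \<in> U" "\<And>y. y \<in> U \<Longrightarrow> y \<noteq> p \<Longrightarrow> (f y - f p) / (y - p) \<noteq> 0"
    unfolding eventually_at_topological by blast
  then have "?S \<inter> U = {p}" using d \<open>p \<in> ?S\<close> by fastforce
  then show "\<exists>U. open U \<and> ?S \<inter> U = {p}" using U(1) by blast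
qed

text \<open>
  The kink of the positive part does no harm, since the derivative vanishes at the level.
\<close>

lemma has_real_derivative_positive_part:
  fixes f :: "real \<Rightarrow> real"
  assumes f: "(f has_real_derivative d) (at t)" and level: "f t = c \<Longrightarrow> d = 0"
  shows "((\<lambda>s. max 0 (f s - c)) has_real_derivative (if f t > c then d else 0)) (at t)"
proof -
  have ft: "(f \<longlongrightarrow> f t) (at t)"
    using f DERIV_isCont isCont_def by blast
  consider "f t > c" | "f t < c" | "f t = c" by linarith
  then show ?thesis
  proof cases
    case 1
    then have "\<forall>\<^sub>F s in at t. f s > c" using ft order_tendstoD(1) by blast
    then have "\<forall>\<^sub>F s in nhds t. f s - c = max 0 (f s - c)"
      using 1 unfolding eventually_nhds_conv_at by (auto elim: eventually_mono)
    moreover have "((\<lambda>s. f s - c) has_real_derivative d) (at t)"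
      using f by (auto intro!: derivative_eq_intros)
    ultimately show ?thesis using 1 by (simp add: DERIV_cong_ev)
  next
    case 2
    then have "\<forall>\<^sub>F s in at t. f s < c" using ft order_tendstoD(2) by blast
    then have "\<forall>\<^sub>F s in nhds t. max 0 (f s - c) = 0"
      using 2 unfolding eventually_nhds_conv_at by (auto elim: eventually_mono)
    then show ?thesis using 2 by (subst DERIV_cong_ev[OF refl _ refl, where g = "\<lambda>_. 0"]) auto
  next
    case 3
    then have "((\<lambda>s. (f s - f t) / (s - t)) \<longlongrightarrow> 0) (at t)"
      using f level by (simp add: has_field_derivative_iff)
    then have "((\<lambda>s. (max 0 (f s - c) - max 0 (f t - c)) / (s - t)) \<longlongrightarrow> 0) (at t)"
      by (rule Lim_null_comparison[rotated, OF tendsto_rabs_zero])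
         (use 3 in \<open>auto simp: abs_divide intro!: always_eventually divide_right_mono\<close>)
    then show ?thesis using 3 by (simp add: has_field_derivative_iff)
  qed
qed


section \<open>Krasovskii values of the quantized dynamics\<close>

text \<open>
  \<open>unit_krasovskii y z\<close> says that \<open>z\<close> lies in the Krasovskii value at \<open>y\<close> of rounding to the nearest
  integer: the integer itself off the jumps, and the interval between the two adjacent integers at a jump. This
  form makes visible both monotonicity and the symmetry under negation, which rounding itself does not have.
\<close>

definition unit_krasovskii :: "real \<Rightarrow> real \<Rightarrow> bool" where
  "unit_krasovskii y z \<longleftrightarrow>
    (\<forall>k::int. (y < of_int k + 1 / 2 \<longrightarrow> z \<le> of_int k) \<and> (of_int k - 1 / 2 < y \<longrightarrow> of_int k \<le> z))"

lemma unit_krasovskii_iff: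
  "unit_krasovskii y z \<longleftrightarrow> z \<in> {of_int (\<lceil>y + 1 / 2\<rceil> - 1)..of_int \<lfloor>y + 1 / 2\<rfloor>}"
proof
  assume z: "unit_krasovskii y z"
  have "y < of_int \<lfloor>y + 1 / 2\<rfloor> + 1 / 2" "of_int (\<lceil>y + 1 / 2\<rceil> - 1) - 1 / 2 < y"
    by linarith+
  then show "z \<in> {of_int (\<lceil>y + 1 / 2\<rceil> - 1)..of_int \<lfloor>y + 1 / 2\<rfloor>}"
    using z unfolding unit_krasovskii_def atLeastAtMost_iff by blast
next
  assume z: "z \<in> {of_int (\<lceil>y + 1 / 2\<rceil> - 1)..of_int \<lfloor>y + 1 / 2\<rfloor>}"
  have "z \<le> of_int k" if "y < of_int k + 1 / 2" for k :: int
  proof -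
    have "\<lfloor>y + 1 / 2\<rfloor> \<le> k" using that by linarith
    then show ?thesis using z by (meson atLeastAtMost_iff of_int_le_iff order_trans)
  qed
  moreover have "of_int k \<le> z" if "of_int k - 1 / 2 < y" for k :: int
  proof -
    have "k \<le> \<lceil>y + 1 / 2\<rceil> - 1" using that by linarith
    then show ?thesis using z by (meson atLeastAtMost_iff of_int_le_iff order_trans)
  qed
  ultimately show "unit_krasovskii y z" unfolding unit_krasovskii_def by blast
qed

lemma unit_krasovskii_uminus: "unit_krasovskii (- y) (- z) \<longleftrightarrow> unit_krasovskii y z"
proof -
  have "unit_krasovskii (- y) (- z)" if "unit_krasovskii y z" for y z
    unfolding unit_krasovskii_def
  proof (intro allI)
    fix k :: int
    show "(- y < of_int k + 1 / 2 \<longrightarrow> - z \<le> of_int k) \<and> (of_int k - 1 / 2 < - y \<longrightarrow> of_int k \<le> - z)"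
      using that unfolding unit_krasovskii_def by (auto dest: spec[of _ "- k"])
  qed
  from this[of y z] this[of "- y" "- z"] show ?thesis by auto
qed

lemma uniform_quantizer_near:
  assumes "0 < \<Delta>"
  shows "\<exists>\<delta>>0. \<forall>s. \<bar>s - y\<bar> < \<delta> \<longrightarrow> unit_krasovskii (y / \<Delta>) (uniform_quantizer \<Delta> s / \<Delta>)"
proof -
  define w where "w = y / \<Delta> + 1 / 2"
  define m where "m = min (of_int \<lfloor>w\<rfloor> + 1 - w) (w - of_int (\<lceil>w\<rceil> - 1))"
  have "0 < m" unfolding m_def by linarith
  define \<delta> where "\<delta> = \<Delta> * m"
  have "0 < \<delta>" unfolding \<delta>_def using assms \<open>0 < m\<close> by simp
  moreover have "unit_krasovskii (y / \<Delta>) (uniform_quantizer \<Delta> s / \<Delta>)" if "\<bar>s - y\<bar> < \<delta>" for s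
  proof -
    have "\<bar>(s / \<Delta> + 1 / 2) - w\<bar> = \<bar>s - y\<bar> / \<Delta>"
      unfolding w_def using assms by (simp add: abs_divide flip: diff_divide_distrib)
    also have "\<dots> < m"
      using that assms unfolding \<delta>_def by (simp add: pos_divide_less_eq mult.commute)
    finally have "\<lceil>w\<rceil> - 1 \<le> \<lfloor>s / \<Delta> + 1 / 2\<rfloor>" "\<lfloor>s / \<Delta> + 1 / 2\<rfloor> \<le> \<lfloor>w\<rfloor>"
      unfolding m_def by linarith+
    moreover have "uniform_quantizer \<Delta> s / \<Delta> = of_int \<lfloor>s / \<Delta> + 1 / 2\<rfloor>"
      using assms by (simp add: uniform_quantizer_def)
    ultimately show ?thesis unfolding unit_krasovskii_iff w_def by simp
  qed
  ultimately show ?thesis by blast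
qed

text \<open>
  Near \<open>y\<close> the vector of quantized components stays in the box whose sides are the Krasovskii values of the
  components. The right-hand side is a linear image of that vector, and the linear image of the box is
  compact and convex, so it contains the closed convex hull.
\<close>

lemma krasovskii_quantized_consensus:
  fixes a :: "'n::finite \<Rightarrow> 'n \<Rightarrow> real \<Rightarrow> real" and y v :: "real ^ 'n"
  assumes "0 < \<Delta>" and v: "v \<in> krasovskii (quantized_consensus a (uniform_quantizer \<Delta>) t) y"
  shows "\<exists>z. (\<forall>i. unit_krasovskii (y $ i / \<Delta>) (z i)) \<and>
    (\<forall>i. v $ i / \<Delta> = (\<Sum>j\<in>UNIV. a i j t * (z j - z i)))"
proof -
  have "\<forall>i. \<exists>\<delta>>0. \<forall>s. \<bar>s - y $ i\<bar> < \<delta> \<longrightarrow> unit_krasovskii (y $ i / \<Delta>) (uniform_quantizer \<Delta> s / \<Delta>)"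
    using uniform_quantizer_near[OF \<open>0 < \<Delta>\<close>] by blast
  then obtain d where d: "\<And>i. d i > 0"
    "\<And>i s. \<bar>s - y $ i\<bar> < d i \<Longrightarrow> unit_krasovskii (y $ i / \<Delta>) (uniform_quantizer \<Delta> s / \<Delta>)"
    by metis
  define \<delta> where "\<delta> = Min (range d)"
  have "0 < \<delta>" "\<And>i. \<delta> \<le> d i" unfolding \<delta>_def using d(1) by auto
  define lo hi :: "real ^ 'n" where "lo = (\<chi> i. of_int (\<lceil>y $ i / \<Delta> + 1 / 2\<rceil> - 1))"
    and "hi = (\<chi> i. of_int \<lfloor>y $ i / \<Delta> + 1 / 2\<rfloor>)"
  define L :: "real ^ 'n \<Rightarrow> real ^ 'n" where "L z = (\<chi> i. \<Delta> * (\<Sum>j\<in>UNIV. a i j t * (z $ j - z $ i)))" for z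
  have "linear L"
    by (rule linearI)
       (auto simp: L_def vec_eq_iff sum.distrib sum_distrib_left algebra_simps sum_subtractf)
  define C where "C = L ` cbox lo hi"
  have "closed C" "convex C"
    unfolding C_def using \<open>linear L\<close>
    by (auto intro!: compact_imp_closed compact_continuous_image linear_continuous_on convex_linear_image
      simp: linear_conv_bounded_linear)
  have "quantized_consensus a (uniform_quantizer \<Delta>) t ` ball y \<delta> \<subseteq> C"
  proof clarify
    fix y' assume y': "y' \<in> ball y \<delta>"
    define z where "z = (\<chi> i. uniform_quantizer \<Delta> (y' $ i) / \<Delta>)"
    have "unit_krasovskii (y $ i / \<Delta>) (z $ i)" for i
    proof -
      have "\<bar>y' $ i - y $ i\<bar> \<le> norm (y' - y)"
        using component_le_norm_cart[of "y' - y" i] by simp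
      also have "\<dots> < d i" using y' \<open>\<delta> \<le> d i\<close> by (simp add: dist_norm norm_minus_commute)
      finally show ?thesis using d(2) by (simp add: z_def)
    qed
    then have "z \<in> cbox lo hi"
      by (simp add: mem_box_cart unit_krasovskii_iff lo_def hi_def)
    moreover have "quantized_consensus a (uniform_quantizer \<Delta>) t y' = L z"
      using \<open>0 < \<Delta>\<close> unfolding quantized_consensus_def L_def z_def
      by (simp add: vec_eq_iff sum_distrib_left diff_divide_distrib algebra_simps)
    ultimately show "quantized_consensus a (uniform_quantizer \<Delta>) t y' \<in> C"
      by (auto simp: C_def)
  qed
  then have "closure (convex hull (quantized_consensus a (uniform_quantizer \<Delta>) t ` ball y \<delta>)) \<subseteq> C"
    using \<open>closed C\<close> \<open>convex C\<close> by (intro closure_minimal hull_minimal)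
  then have "v \<in> C" using v \<open>0 < \<delta>\<close> unfolding krasovskii_def by auto
  then obtain z where z: "z \<in> cbox lo hi" "v = L z" by (auto simp: C_def)
  have "\<forall>i. unit_krasovskii (y $ i / \<Delta>) (z $ i)"
    using z(1) by (simp add: mem_box_cart unit_krasovskii_iff lo_def hi_def)
  moreover have "\<forall>i. v $ i / \<Delta> = (\<Sum>j\<in>UNIV. a i j t * (z $ j - z $ i))"
    using \<open>0 < \<Delta>\<close> by (simp add: z(2) L_def)
  ultimately show ?thesis by blast
qed


section \<open>A globally reachable agent\<close>

lemma reachable_limit_graph_iff:
  fixes a :: "'n \<Rightarrow> 'n \<Rightarrow> real \<Rightarrow> real"
  shows "i \<rightarrow>\<^sup>*\<^bsub>with_proj (limit_graph a)\<^esub> j \<longleftrightarrow> (i, j) \<in> (parcs (limit_graph a))\<^sup>*"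
proof -
  interpret wf_digraph "with_proj (limit_graph a)"
    by unfold_locales (auto simp: limit_graph_def)
  show ?thesis
  proof
    assume "i \<rightarrow>\<^sup>*\<^bsub>with_proj (limit_graph a)\<^esub> j"
    then show "(i, j) \<in> (parcs (limit_graph a))\<^sup>*"
      by (auto simp: reachable_def dest: rtrancl_on_rtranclI)
  next
    assume "(i, j) \<in> (parcs (limit_graph a))\<^sup>*"
    then show "i \<rightarrow>\<^sup>*\<^bsub>with_proj (limit_graph a)\<^esub> j"
    proof induction
      case base
      show ?case by (rule reachable_refl) (simp add: limit_graph_def)
    next
      case (step j k)
      then show ?case by (auto intro: reachable_adj_trans)
    qed
  qed
qed

text \<open>
  In the condensation, the sink \<open>V\<close> reaches no other component, so comparability makes every component reach
  \<open>V\<close>. A path in the condensation lifts to paths of agents that end in an arbitrary agent \<open>r\<close> of \<open>V\<close>.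
\<close>

lemma exists_globally_reachable_node:
  fixes a :: "'n \<Rightarrow> 'n \<Rightarrow> real \<Rightarrow> real"
  assumes uc: "unilaterally_connected (with_proj (condensation (with_proj (limit_graph a))))"
    and sink: "is_sink (with_proj (condensation (with_proj (limit_graph a)))) V"
  shows "\<exists>r. \<forall>i. (i, r) \<in> (parcs (limit_graph a))\<^sup>*"
proof -
  define G where "G = with_proj (limit_graph a)"
  define T where "T = with_proj (condensation G)"
  interpret wf_digraph G
    unfolding G_def by unfold_locales (auto simp: limit_graph_def)
  have vT: "verts T = sccs_verts" by (simp add: T_def condensation_def sccs_verts_conv)
  interpret T: wf_digraph T
    unfolding T_def by unfold_locales (auto simp: condensation_def)
  have V: "V \<in> sccs_verts" using sink vT unfolding is_sink_def T_def G_def by metis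
  have no_out: "\<not> V \<rightarrow>\<^bsub>T\<^esub> W" for W
    using sink unfolding is_sink_def T_def G_def by (auto simp: out_arcs_def)
  have to_V: "W \<rightarrow>\<^sup>*\<^bsub>T\<^esub> V" if W: "W \<in> sccs_verts" for W
  proof (rule ccontr)
    assume n: "\<not> W \<rightarrow>\<^sup>*\<^bsub>T\<^esub> V"
    then have "V \<rightarrow>\<^sup>*\<^bsub>T\<^esub> W"
      using uc V W vT unfolding unilaterally_connected_def T_def G_def by metis
    then have "V = W" using no_out by (metis T.converse_reachable_cases)
    then show False using n V vT by auto
  qed
  obtain r where "r \<in> V" using V by (auto simp: in_sccs_verts_conv_reachable)
  have step: "\<forall>i\<in>W. i \<rightarrow>\<^sup>*\<^bsub>G\<^esub> r" if "W \<rightarrow>\<^sup>*\<^bsub>T\<^esub> V" for W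
    using that
  proof (induction rule: T.converse_reachable_induct)
    case base
    then show ?case using V \<open>r \<in> V\<close> by (auto simp: in_sccs_verts_conv_reachable)
  next
    case (step W W')
    from step(1) obtain v w where vw: "W \<in> sccs_verts" "v \<in> W" "w \<in> W'" "v \<rightarrow>\<^bsub>G\<^esub> w"
      by (auto simp: T_def condensation_def sccs_verts_conv)
    show ?case
    proof
      fix i assume "i \<in> W"
      then have "i \<rightarrow>\<^sup>*\<^bsub>G\<^esub> v" using vw by (simp add: in_sccs_verts_conv_reachable)
      also have "v \<rightarrow>\<^bsub>G\<^esub> w" by fact
      also have "w \<rightarrow>\<^sup>*\<^bsub>G\<^esub> r" using step vw by blast
      finally show "i \<rightarrow>\<^sup>*\<^bsub>G\<^esub> r" .
    qed
  qed
  have "i \<rightarrow>\<^sup>*\<^bsub>G\<^esub> r" for i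
  proof -
    have "i \<in> verts G" by (simp add: G_def limit_graph_def)
    then have "scc_of i \<in> sccs_verts" "i \<in> scc_of i"
      by (auto intro: scc_of_in_sccs_verts in_scc_of_self)
    then show ?thesis using step[OF to_V] by blast
  qed
  then show ?thesis unfolding G_def reachable_limit_graph_iff by blast
qed


section \<open>Quantized flows\<close>

definition velocity :: "('n::finite \<Rightarrow> 'n \<Rightarrow> real \<Rightarrow> real) \<Rightarrow> real \<Rightarrow> ('n \<Rightarrow> real) \<Rightarrow> 'n \<Rightarrow> real" where
  "velocity a t z i = (\<Sum>j\<in>UNIV. a i j t * (z j - z i))"

text \<open>
  The times at which a selection \<open>z\<close> exists are the good ones: the differential inclusion holds and every
  agent located at a jump of the quantizer is at rest.
\<close>

definition selection_at ::
    "('n::finite \<Rightarrow> 'n \<Rightarrow> real \<Rightarrow> real) \<Rightarrow> ('n \<Rightarrow> real \<Rightarrow> real) \<Rightarrow> real \<Rightarrow> ('n \<Rightarrow> real) \<Rightarrow> bool" where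
  "selection_at a x t z \<longleftrightarrow> 0 < t \<and>
    (\<forall>i. unit_krasovskii (x i t) (z i)) \<and>
    (\<forall>i. (x i has_real_derivative velocity a t z i) (at t)) \<and>
    (\<forall>i k. x i t = of_int k + 1 / 2 \<longrightarrow> velocity a t z i = 0)"

text \<open>
  The total height above the lower end of the level that rounds to \<open>h\<close>. Its counterpart for the lowest level
  \<open>l\<close> is the excess of the reflected motion \<open>-x\<close> over the level \<open>-l\<close>.
\<close>

definition upper_excess :: "('n::finite \<Rightarrow> real \<Rightarrow> real) \<Rightarrow> int \<Rightarrow> real \<Rightarrow> real" where
  "upper_excess x h t = (\<Sum>i\<in>UNIV. max 0 (x i t - (of_int h - 1 / 2)))"

lemma upper_excess_nonneg: "0 \<le> upper_excess x h t"
  unfolding upper_excess_def by (intro sum_nonneg) auto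

lemma upper_excess_pos:
  assumes "of_int h - 1 / 2 < x i t"
  shows "0 < upper_excess x h t"
  unfolding upper_excess_def by (rule sum_pos2[of _ i]) (use assms in auto)

lemma upper_excess_lipschitz: "\<bar>upper_excess x h v - upper_excess x h u\<bar> \<le> (\<Sum>i\<in>UNIV. \<bar>x i v - x i u\<bar>)"
  unfolding upper_excess_def sum_subtractf[symmetric]
  by (rule order_trans[OF sum_abs]) (intro sum_mono, auto)

lemma velocity_uminus: "velocity a t (\<lambda>i. - z i) i = - velocity a t z i"
  by (simp add: velocity_def algebra_simps flip: sum_negf)

lemma selection_at_uminus:
  assumes "selection_at a x t z"
  shows "selection_at a (\<lambda>i t. - x i t) t (\<lambda>i. - z i)"
proof -
  have "velocity a t z i = 0" if "- x i t = of_int k + 1 / 2" for i and k :: int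
  proof -
    have "x i t = of_int (- k - 1) + 1 / 2" using that by simp
    then show ?thesis using assms unfolding selection_at_def by blast
  qed
  then show ?thesis
    using assms unfolding selection_at_def
    by (auto simp: unit_krasovskii_uminus velocity_uminus intro!: DERIV_minus)
qed

text \<open>
  Solutions in units of the quantization step, with edge set \<open>E\<close>. Absolute continuity is available on compact
  intervals of positive times only; the initial state enters through the one-sided limit. The assumptions are
  invariant under \<open>x \<mapsto> -x\<close>, so statements about upper levels yield those about lower levels.
\<close>

locale quantized_flow =
  fixes a :: "'n::finite \<Rightarrow> 'n \<Rightarrow> real \<Rightarrow> real" and E :: "('n \<times> 'n) set"
    and a_min a_max :: real and x :: "'n \<Rightarrow> real \<Rightarrow> real"
  assumes a_min_pos: "0 < a_min" and a_min_le: "a_min \<le> a_max"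
    and weight_edge: "\<And>i j t. (i, j) \<in> E \<Longrightarrow> 0 \<le> t \<Longrightarrow> a i j t \<in> {a_min..a_max}"
    and weight_no_edge: "\<And>i j t. (i, j) \<notin> E \<Longrightarrow> 0 \<le> t \<Longrightarrow> a i j t = 0"
    and abs_cont: "\<And>i s t. 0 < s \<Longrightarrow> absolutely_continuous_on {s..t} (x i)"
    and initial: "\<And>i. (x i \<longlongrightarrow> x i 0) (at_right 0)"
    and dynamics: "AE t in lebesgue. 0 < t \<longrightarrow>
      (\<exists>z. (\<forall>i. unit_krasovskii (x i t) (z i)) \<and> (\<forall>i. (x i has_real_derivative velocity a t z i) (at t)))"
begin

lemma uminus_flow: "quantized_flow a E a_min a_max (\<lambda>i t. - x i t)"
proof
  show "absolutely_continuous_on {s..t} (\<lambda>t. - x i t)" if "0 < s" for i s t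
    by (rule absolutely_continuous_on_dominated[where I = "{i}" and g = x and C = 1])
       (use abs_cont[OF that] in auto)
  show "AE t in lebesgue. 0 < t \<longrightarrow> (\<exists>z. (\<forall>i. unit_krasovskii (- x i t) (z i)) \<and>
      (\<forall>i. ((\<lambda>t. - x i t) has_real_derivative velocity a t z i) (at t)))"
    using dynamics
  proof eventually_elim
    case (elim t)
    show ?case
    proof
      assume "0 < t"
      then obtain z where "\<forall>i. unit_krasovskii (x i t) (z i)"
        "\<forall>i. (x i has_real_derivative velocity a t z i) (at t)"
        using elim by blast
      then show "\<exists>z. (\<forall>i. unit_krasovskii (- x i t) (z i)) \<and>
          (\<forall>i. ((\<lambda>t. - x i t) has_real_derivative velocity a t z i) (at t))"
        by (intro exI[of _ "\<lambda>i. - z i"])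
           (auto simp: unit_krasovskii_uminus velocity_uminus intro!: DERIV_minus)
    qed
  qed
qed (use a_min_pos a_min_le weight_edge weight_no_edge initial in \<open>auto intro!: tendsto_minus\<close>)

lemma weight_nonneg: "0 \<le> t \<Longrightarrow> 0 \<le> a i j t"
  using weight_edge[of i j t] weight_no_edge[of i j t] a_min_pos by (cases "(i, j) \<in> E") auto

lemma weight_le: "0 \<le> t \<Longrightarrow> a i j t \<le> a_max"
  using weight_edge[of i j t] weight_no_edge[of i j t] a_min_pos a_min_le by (cases "(i, j) \<in> E") auto

text \<open>
  There are countably many agents and jumps, and each jump is crossed with nonzero speed at countably many
  times only.
\<close>

lemma AE_selection: "AE t in lebesgue. 0 < t \<longrightarrow> (\<exists>z. selection_at a x t z)"
proof -
  define B where "B = (\<Union>i. \<Union>k::int. {t. x i t = of_int k + 1 / 2 \<and>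
    (\<exists>d. d \<noteq> 0 \<and> (x i has_real_derivative d) (at t))})"
  have "countable B"
    unfolding B_def by (intro countable_UN countable_transversal_level) auto
  then have "B \<in> null_sets lebesgue"
    by (intro null_sets_completionI countable_imp_null_set_lborel)
  from AE_not_in[OF this] dynamics show ?thesis
  proof eventually_elim
    case (elim t)
    show ?case
    proof
      assume "0 < t"
      then obtain z where z: "\<forall>i. unit_krasovskii (x i t) (z i)"
        "\<forall>i. (x i has_real_derivative velocity a t z i) (at t)"
        using elim by blast
      have "selection_at a x t z"
        using \<open>0 < t\<close> z \<open>t \<notin> B\<close> unfolding selection_at_def B_def by blast
      then show "\<exists>z. selection_at a x t z" by blast
    qed
  qed
qed

text \<open>
  The form in which the mean value inequality is used: the function is controlled by the motion of the agents,
  and time 0 is reached by passing to the limit from the right.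
\<close>

lemma growth_bound:
  fixes f :: "real \<Rightarrow> real"
  assumes st: "0 \<le> s" "s \<le> t"
    and dom: "\<And>u v. \<bar>f v - f u\<bar> \<le> C * (\<Sum>i\<in>UNIV. \<bar>x i v - x i u\<bar>)"
    and sec: "\<And>\<tau> z. s < \<tau> \<Longrightarrow> \<tau> < t \<Longrightarrow> selection_at a x \<tau> z \<Longrightarrow> secant_bound f c \<tau>"
  shows "f t - f s \<le> c * (t - s)"
proof -
  have pos: "f t - f s' \<le> c * (t - s')" if "0 < s'" "s \<le> s'" "s' \<le> t" for s'
  proof (rule absolutely_continuous_growth_bound[OF \<open>s' \<le> t\<close>])
    show "absolutely_continuous_on {s'..t} f"
      by (rule absolutely_continuous_on_dominated[where I = UNIV and g = x and C = C])
         (use abs_cont[OF \<open>0 < s'\<close>] dom in auto)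
    show "AE \<tau> in lebesgue. s' < \<tau> \<longrightarrow> \<tau> < t \<longrightarrow> secant_bound f c \<tau>"
      using AE_selection by eventually_elim (use that sec in force)
  qed
  show ?thesis
  proof (cases "s = 0 \<and> 0 < t")
    case True
    have "((\<lambda>s'. C * (\<Sum>i\<in>UNIV. \<bar>x i s' - x i 0\<bar>)) \<longlongrightarrow> C * (\<Sum>i\<in>UNIV. \<bar>x i 0 - x i 0\<bar>)) (at_right 0)"
      by (intro tendsto_intros initial)
    then have "((\<lambda>s'. C * (\<Sum>i\<in>UNIV. \<bar>x i s' - x i 0\<bar>)) \<longlongrightarrow> 0) (at_right 0)" by simp
    then have "((\<lambda>s'. f s' - f 0) \<longlongrightarrow> 0) (at_right 0)"
      by (rule Lim_null_comparison[rotated]) (use dom in \<open>auto intro: always_eventually\<close>)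
    then have f0: "(f \<longlongrightarrow> f 0) (at_right 0)"
      by (simp add: LIM_zero_iff)
    have "((\<lambda>s'. f t - f s') \<longlongrightarrow> f t - f 0) (at_right 0)"
      "((\<lambda>s'. c * (t - s')) \<longlongrightarrow> c * (t - 0)) (at_right 0)"
      by (intro tendsto_intros f0)+
    moreover have "\<forall>\<^sub>F s' in at_right 0. f t - f s' \<le> c * (t - s')"
      using eventually_at_right_real[of 0 t] True by (auto elim!: eventually_mono intro!: pos)
    ultimately have "f t - f 0 \<le> c * (t - 0)"
      by (intro tendsto_le[of "at_right 0" _ _ "\<lambda>s'. f t - f s'"]) auto
    then show ?thesis using True by simp
  next
    case False
    then show ?thesis using st pos[of s] by (cases "s = t") auto
  qed
qed


section \<open>Invariant bounds and the maximum principle\<close>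

text \<open>
  Off the jumps, an agent at least as high as its neighbours has a quantized value at least as high as
  theirs. On a jump this fails, but there the agent is at rest.
\<close>

lemma argmax_velocity_nonpos:
  assumes sel: "selection_at a x t z" and closed: "\<And>j. (i, j) \<in> E \<Longrightarrow> x j t \<le> x i t"
  shows "velocity a t z i \<le> 0"
proof (cases "\<exists>k::int. x i t = of_int k + 1 / 2")
  case True
  then show ?thesis using sel unfolding selection_at_def by auto
next
  case False
  define k where "k = \<lfloor>x i t + 1 / 2\<rfloor>"
  have k: "of_int k - 1 / 2 \<le> x i t" "x i t < of_int k + 1 / 2" unfolding k_def by linarith+
  moreover have "x i t \<noteq> of_int (k - 1) + 1 / 2" using False by blast
  ultimately have "of_int k - 1 / 2 < x i t" by simp
  then have zi: "of_int k \<le> z i" using sel unfolding selection_at_def unit_krasovskii_def by blast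
  have "0 \<le> t" using sel unfolding selection_at_def by simp
  have "a i j t * (z j - z i) \<le> 0" for j
  proof (cases "(i, j) \<in> E")
    case True
    then have "x j t < of_int k + 1 / 2" using closed[OF True] k by simp
    then have "z j \<le> of_int k" using sel unfolding selection_at_def unit_krasovskii_def by blast
    then show ?thesis using zi weight_nonneg[OF \<open>0 \<le> t\<close>] by (simp add: mult_le_0_iff)
  qed (simp add: weight_no_edge \<open>0 \<le> t\<close>)
  then show ?thesis unfolding velocity_def by (intro sum_nonpos) auto
qed

text \<open>
  The maximum \<open>g\<close> over \<open>S\<close> does not increase: just before and after \<open>\<tau>\<close> only agents attaining the maximum at
  \<open>\<tau>\<close> matter, and those do not move upwards.
\<close>

lemma upper_bound_invariant:
  assumes st: "0 \<le> s" "s \<le> t" and closed: "\<And>i j. i \<in> S \<Longrightarrow> (i, j) \<in> E \<Longrightarrow> j \<in> S"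
    and bound: "\<And>i. i \<in> S \<Longrightarrow> x i s \<le> c" and "i \<in> S"
  shows "x i t \<le> c"
proof -
  define g where "g t = Max ((\<lambda>i. x i t) ` S)" for t
  have fin: "finite S" "S \<noteq> {}" using \<open>i \<in> S\<close> by auto
  have g_ge: "x j t \<le> g t" if "j \<in> S" for j t
    unfolding g_def using that fin by simp
  have g_att: "\<exists>j\<in>S. g t = x j t" for t
  proof -
    have "g t \<in> (\<lambda>i. x i t) ` S" unfolding g_def using fin by (intro Max_in) auto
    then show ?thesis by auto
  qed
  have le: "g v - g u \<le> (\<Sum>i\<in>UNIV. \<bar>x i v - x i u\<bar>)" for u v
  proof -
    obtain j where j: "j \<in> S" "g v = x j v" using g_att by blast
    have "g v - g u \<le> \<bar>x j v - x j u\<bar>" using j g_ge[of j u] by linarith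
    also have "\<dots> \<le> (\<Sum>i\<in>UNIV. \<bar>x i v - x i u\<bar>)" by (rule member_le_sum) auto
    finally show ?thesis .
  qed
  have "g t - g s \<le> 0 * (t - s)"
  proof (rule growth_bound[OF st, where C = 1])
    show "\<bar>g v - g u\<bar> \<le> 1 * (\<Sum>i\<in>UNIV. \<bar>x i v - x i u\<bar>)" for u v
      using le[of v u] le[of u v] by (simp add: abs_le_iff abs_minus_commute)
    fix \<tau> z assume sel: "selection_at a x \<tau> z"
    have der: "(x j has_real_derivative velocity a \<tau> z j) (at \<tau>)" for j
      using sel unfolding selection_at_def by blast
    obtain m where m: "m \<in> S" "g \<tau> = x m \<tau>" using g_att by blast
    show "secant_bound g 0 \<tau>"
      unfolding secant_bound_def
    proof (intro allI impI)
      fix \<eta> :: real assume "0 < \<eta>"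
      \<comment> \<open>An agent that is not maximal at \<open>\<tau>\<close> does not realise \<open>g v\<close> shortly afterwards.\<close>
      have "\<exists>\<delta>>0. \<forall>u v. u \<in> ball \<tau> \<delta> \<and> v \<in> ball \<tau> \<delta> \<and> u \<le> \<tau> \<and> \<tau> \<le> v \<longrightarrow>
          x j v < g v \<or> x j v - x j u \<le> (0 + \<eta>) * (v - u)" if "j \<in> S" for j
      proof (cases "x j \<tau> = g \<tau>")
        case True
        then have "velocity a \<tau> z j \<le> 0"
          using closed[OF \<open>j \<in> S\<close>] g_ge by (intro argmax_velocity_nonpos[OF sel]) auto
        then have "secant_bound (x j) 0 \<tau>" by (rule secant_bound_if_derivative[OF der])
        then show ?thesis using \<open>0 < \<eta>\<close> unfolding secant_bound_def by blast
      next
        case False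
        then have "x j \<tau> < x m \<tau>" using g_ge[OF \<open>j \<in> S\<close>, of \<tau>] m by simp
        moreover have "isCont (\<lambda>v. x m v - x j v) \<tau>"
          using der by (intro continuous_diff DERIV_isCont)
        ultimately have "\<forall>\<^sub>F v in nhds \<tau>. 0 < x m v - x j v"
          using tendsto_at_iff_tendsto_nhds[of "\<lambda>v. x m v - x j v" \<tau>]
          by (intro order_tendstoD(1)[of _ "x m \<tau> - x j \<tau>"]) (auto simp: isCont_def)
        then obtain \<delta> where "0 < \<delta>" and near: "\<And>v. dist v \<tau> < \<delta> \<Longrightarrow> x j v < x m v"
          unfolding eventually_nhds_metric by auto
        have "x j v < g v" if "v \<in> ball \<tau> \<delta>" for v
        proof -
          have "x j v < x m v" using near that by (simp add: dist_commute)
          also have "\<dots> \<le> g v" by (rule g_ge[OF m(1)])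
          finally show ?thesis .
        qed
        then show ?thesis using \<open>0 < \<delta>\<close> by blast
      qed
      then obtain d where d: "\<And>j. j \<in> S \<Longrightarrow> d j > 0"
        "\<And>j u v. j \<in> S \<Longrightarrow> u \<in> ball \<tau> (d j) \<Longrightarrow> v \<in> ball \<tau> (d j) \<Longrightarrow> u \<le> \<tau> \<Longrightarrow> \<tau> \<le> v \<Longrightarrow>
          x j v < g v \<or> x j v - x j u \<le> (0 + \<eta>) * (v - u)"
        by metis
      define \<delta> where "\<delta> = Min (d ` S)"
      have \<delta>: "0 < \<delta>" "\<And>j. j \<in> S \<Longrightarrow> \<delta> \<le> d j" unfolding \<delta>_def using fin d(1) by auto
      have "g v - g u \<le> (0 + \<eta>) * (v - u)"
        if "u \<in> ball \<tau> \<delta>" "v \<in> ball \<tau> \<delta>" "u \<le> \<tau>" "\<tau> \<le> v" for u v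
      proof -
        obtain j where j: "j \<in> S" "g v = x j v" using g_att by blast
        have "x j v - x j u \<le> (0 + \<eta>) * (v - u)"
          using d(2)[OF j(1), of u v] \<delta>(2)[OF j(1)] j(2) that by auto
        then show ?thesis using j g_ge[of j u] by linarith
      qed
      then show "\<exists>\<delta>>0. \<forall>u v. u \<in> ball \<tau> \<delta> \<and> v \<in> ball \<tau> \<delta> \<and> u \<le> \<tau> \<and> \<tau> \<le> v \<longrightarrow>
          g v - g u \<le> (0 + \<eta>) * (v - u)"
        using \<delta>(1) by blast
    qed
  qed
  moreover have "g s \<le> c" using g_att[of s] bound by auto
  ultimately show ?thesis using g_ge[OF \<open>i \<in> S\<close>, of t] by simp
qed

lemma lower_bound_invariant:
  assumes "0 \<le> s" "s \<le> t" and "\<And>i j. i \<in> S \<Longrightarrow> (i, j) \<in> E \<Longrightarrow> j \<in> S"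
    and "\<And>i. i \<in> S \<Longrightarrow> c \<le> x i s" and "i \<in> S"
  shows "c \<le> x i t"
  using quantized_flow.upper_bound_invariant[OF uminus_flow, of s t S "- c" i] assms by simp

text \<open>
  A maximum principle. If the largest value \<open>m\<close> of \<open>z\<close> exceeded \<open>h\<close>, every agent with this value would sit at
  the top \<open>h + 1/2\<close>, which is a jump, and hence be at rest. Being at rest with the largest value forces the same
  value on all neighbours. The value would thus propagate to \<open>r\<close> and on to \<open>j\<close>, which is not at the top.
\<close>

lemma selection_le_level:
  assumes sel: "selection_at a x t z" and below: "\<And>i. x i t \<le> of_int h + 1 / 2"
    and root: "\<And>i. (i, r) \<in> E\<^sup>*" and j: "(r, j) \<in> E\<^sup>*" "x j t \<noteq> of_int h + 1 / 2"
  shows "z i \<le> of_int h"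
proof (rule ccontr)
  assume "\<not> z i \<le> of_int h"
  define m where "m = Max (range z)"
  have m_ge: "z k \<le> m" for k unfolding m_def by simp
  then have "of_int h < m" using \<open>\<not> z i \<le> of_int h\<close> by (meson less_le_trans not_le)
  have "0 \<le> t" using sel unfolding selection_at_def by simp
  have on_top: "x k t = of_int h + 1 / 2" if "z k = m" for k
  proof (rule ccontr)
    assume "x k t \<noteq> of_int h + 1 / 2"
    then have "x k t < of_int h + 1 / 2" using below[of k] by simp
    then have "z k \<le> of_int h" using sel unfolding selection_at_def unit_krasovskii_def by blast
    then show False using that \<open>of_int h < m\<close> by simp
  qed
  have closed: "z l = m" if "z k = m" "(k, l) \<in> E" for k l
  proof -
    have "velocity a t z k = 0"
      using on_top[OF that(1)] sel unfolding selection_at_def by blast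
    then have "(\<Sum>l\<in>UNIV. a k l t * (m - z l)) = 0"
      using that(1) unfolding velocity_def by (simp add: algebra_simps sum_subtractf)
    then have "a k l t * (m - z l) = 0"
      using m_ge weight_nonneg[OF \<open>0 \<le> t\<close>] by (subst (asm) sum_nonneg_eq_0_iff) auto
    then show ?thesis using weight_edge[OF that(2) \<open>0 \<le> t\<close>] a_min_pos by auto
  qed
  have reach: "z l = m" if "(k, l) \<in> E\<^sup>*" "z k = m" for k l
    using that by induction (use closed in blast)+
  have "m \<in> range z" unfolding m_def by (intro Max_in) auto
  then obtain k where "z k = m" by auto
  then have "z j = m" using reach root j(1) by blast
  then show False using on_top j(2) by blast
qed


section \<open>Decay of the extreme levels\<close>

text \<open>
  The factor lost by a deficit when it passes one edge backwards through an agent at rest, and the guaranteed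
  speed obtained after at most \<open>N - 2\<close> such passages. The factor one half comes from the initial deficit of \<open>r\<close>.
\<close>

definition attenuation :: real where
  "attenuation = a_min / (real CARD('n) * a_max)"

definition decay_rate :: real where
  "decay_rate = a_min * attenuation ^ (CARD('n) - 2) / 2"

lemma attenuation_bounds: "0 < attenuation" "attenuation * real CARD('n) \<le> 1" "attenuation \<le> 1"
proof -
  have "0 < real CARD('n)" "1 \<le> real CARD('n)" by (auto simp: Suc_leI)
  moreover have "0 < a_max" using a_min_pos a_min_le by simp
  ultimately show "0 < attenuation" "attenuation * real CARD('n) \<le> 1"
    using a_min_pos a_min_le unfolding attenuation_def by (auto simp: field_simps)
  then show "attenuation \<le> 1"
  proof -
    have "attenuation * 1 \<le> attenuation * real CARD('n)"
      using \<open>0 < attenuation\<close> \<open>1 \<le> real CARD('n)\<close> by (intro mult_left_mono) auto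
    then show ?thesis using \<open>attenuation * real CARD('n) \<le> 1\<close> by linarith
  qed
qed

lemma decay_rate_pos: "0 < decay_rate"
  unfolding decay_rate_def using a_min_pos attenuation_bounds by simp

lemma upper_velocity_nonpos:
  assumes sel: "selection_at a x t z" and le: "\<And>i. z i \<le> of_int h" and i: "of_int h - 1 / 2 < x i t"
  shows "velocity a t z i \<le> 0"
proof -
  have "of_int h \<le> z i" using sel i unfolding selection_at_def unit_krasovskii_def by blast
  moreover have "0 \<le> t" using sel unfolding selection_at_def by simp
  ultimately show ?thesis
    unfolding velocity_def using order_trans[OF le]
    by (intro sum_nonpos mult_nonneg_nonpos weight_nonneg) auto
qed

text \<open>
  The sets \<open>Y n\<close> of agents with deficit at least \<open>\<kappa>^n / 2\<close> start with \<open>r\<close>. Unless an agent of the top level \<open>U\<close>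
  has an edge into \<open>Y n\<close>, the set grows by at least one agent at the next step, because every agent can reach
  \<open>r\<close>. As \<open>u\<close> has deficit zero it never enters, so the growth must stop at the latest at \<open>n = N - 2\<close> with an
  edge from \<open>U\<close> into \<open>Y n\<close>.
\<close>

lemma upper_velocity_decay:
  assumes sel: "selection_at a x t z" and le: "\<And>i. z i \<le> of_int h"
    and root: "\<And>i. (i, r) \<in> E\<^sup>*" and r: "z r \<le> of_int h - 1 / 2" and u: "of_int h - 1 / 2 < x u t"
  shows "(\<Sum>i | of_int h - 1 / 2 < x i t. velocity a t z i) \<le> - decay_rate"
proof -
  define U where "U = {i. of_int h - 1 / 2 < x i t}"
  define y where "y i = of_int h - z i" for i
  define Y where "Y n = {i. attenuation ^ n / 2 \<le> y i}" for n
  have "0 \<le> t" using sel unfolding selection_at_def by simp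
  have y_nonneg: "0 \<le> y i" for i using le by (simp add: y_def)
  have vel: "velocity a t z i = y i * (\<Sum>j\<in>UNIV. a i j t) - (\<Sum>j\<in>UNIV. a i j t * y j)" for i
    unfolding velocity_def y_def by (simp add: algebra_simps sum_subtractf sum_distrib_left sum.distrib)
  have y_U: "y i = 0" if "i \<in> U" for i
  proof -
    have "of_int h \<le> z i"
      using that sel unfolding U_def selection_at_def unit_krasovskii_def by blast
    then show ?thesis using le[of i] by (simp add: y_def)
  qed
  have not_Y: "u \<notin> Y n" for n
    using y_U[of u] u attenuation_bounds(1) by (auto simp: U_def Y_def not_le)
  have edge_sum: "a_min * y j \<le> (\<Sum>j\<in>UNIV. a i j t * y j)" if "(i, j) \<in> E" for i j
  proof -
    have "a_min * y j \<le> a i j t * y j"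
      using weight_edge[OF that \<open>0 \<le> t\<close>] y_nonneg by (intro mult_right_mono) auto
    also have "\<dots> \<le> (\<Sum>j\<in>UNIV. a i j t * y j)"
      using weight_nonneg[OF \<open>0 \<le> t\<close>] y_nonneg by (intro member_le_sum) auto
    finally show ?thesis .
  qed
  have pow_le: "attenuation ^ n \<le> attenuation ^ m" if "m \<le> n" for m n
    using that attenuation_bounds by (intro power_decreasing) auto
  \<comment> \<open>On the threshold the deficit is a mean over the neighbours; below it is at least 1.\<close>
  have step: "i \<in> Y (Suc n)" if "i \<notin> U" "(i, j) \<in> E" "j \<in> Y n" for i j n
  proof (cases "x i t = of_int h - 1 / 2")
    case True
    then have "x i t = of_int (h - 1) + 1 / 2" by simp
    then have "velocity a t z i = 0" using sel unfolding selection_at_def by blast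
    then have "a_min * y j \<le> y i * (\<Sum>j\<in>UNIV. a i j t)"
      using edge_sum[OF that(2)] vel[of i] by simp
    also have "\<dots> \<le> y i * (real CARD('n) * a_max)"
      using sum_bounded_above[of UNIV "\<lambda>j. a i j t" a_max] weight_le[OF \<open>0 \<le> t\<close>] y_nonneg
      by (intro mult_left_mono) auto
    finally have "attenuation * y j \<le> y i"
      using a_min_pos a_min_le unfolding attenuation_def by (simp add: field_simps)
    moreover have "attenuation ^ Suc n / 2 \<le> attenuation * y j"
      using that(3) attenuation_bounds(1) by (simp add: Y_def)
    ultimately show ?thesis by (simp add: Y_def)
  next
    case False
    then have "x i t < of_int (h - 1) + 1 / 2" using that(1) by (simp add: U_def)
    then have "z i \<le> of_int (h - 1)" using sel unfolding selection_at_def unit_krasovskii_def by blast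
    then show ?thesis using pow_le[of 0 "Suc n"] by (simp add: Y_def y_def)
  qed
  have Y_mono: "Y n \<subseteq> Y (Suc n)" for n
    using pow_le[of n "Suc n"] by (auto simp: Y_def)
  have r_Y: "r \<in> Y n" for n
    using r pow_le[of 0 n] by (simp add: Y_def y_def)
  have "\<exists>n\<le>CARD('n) - 2. \<exists>i\<in>U. \<exists>j\<in>Y n. (i, j) \<in> E"
  proof (rule ccontr)
    assume none: "\<not> ?thesis"
    have "n + 1 \<le> card (Y n)" if "n \<le> CARD('n) - 1" for n
      using that
    proof (induction n)
      case 0
      have "card {r} \<le> card (Y 0)" using r_Y by (intro card_mono) auto
      then show ?case by simp
    next
      case (Suc n)
      have "\<exists>i j. (i, j) \<in> E \<and> i \<notin> Y n \<and> j \<in> Y n"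
      proof (rule ccontr)
        assume closed: "\<not> ?thesis"
        have "k \<in> Y n" if "(k, r) \<in> E\<^sup>*" for k
          using that by (induction rule: converse_rtrancl_induct) (use r_Y closed in blast)+
        then show False using root not_Y by blast
      qed
      then obtain i j where ij: "(i, j) \<in> E" "i \<notin> Y n" "j \<in> Y n" by blast
      have "n \<le> CARD('n) - 2" using Suc.prems by simp
      then have "i \<notin> U" using none ij by blast
      then have "insert i (Y n) \<subseteq> Y (Suc n)" using step ij Y_mono by blast
      then have "card (insert i (Y n)) \<le> card (Y (Suc n))" by (intro card_mono) auto
      then show ?case using Suc ij(2) by simp
    qed
    from this[of "CARD('n) - 1"] have "CARD('n) \<le> card (Y (CARD('n) - 1))" by simp
    then have "Y (CARD('n) - 1) = UNIV" by (intro card_seteq) auto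
    then show False using not_Y by blast
  qed
  then obtain n i j where n: "n \<le> CARD('n) - 2" "i \<in> U" "j \<in> Y n" "(i, j) \<in> E" by blast
  have "velocity a t z i = - (\<Sum>j\<in>UNIV. a i j t * y j)" using vel[of i] y_U[OF n(2)] by simp
  also have "\<dots> \<le> - (a_min * y j)" using edge_sum[OF n(4)] by simp
  also have "\<dots> \<le> - decay_rate"
  proof -
    have "decay_rate \<le> a_min * (attenuation ^ n / 2)"
      unfolding decay_rate_def using pow_le[OF n(1)] a_min_pos by simp
    also have "\<dots> \<le> a_min * y j"
      using n(3) a_min_pos by (intro mult_left_mono) (auto simp: Y_def)
    finally show ?thesis by simp
  qed
  finally have vi: "velocity a t z i \<le> - decay_rate" .
  have "(\<Sum>k\<in>U. velocity a t z k) = velocity a t z i + (\<Sum>k\<in>U - {i}. velocity a t z k)"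
    using n(2) by (intro sum.remove) auto
  also have "(\<Sum>k\<in>U - {i}. velocity a t z k) \<le> 0"
    using upper_velocity_nonpos[OF sel le] by (intro sum_nonpos) (auto simp: U_def)
  finally show ?thesis using vi by (simp add: U_def)
qed

lemma upper_excess_derivative:
  assumes sel: "selection_at a x t z"
  shows "(upper_excess x h has_real_derivative (\<Sum>i | of_int h - 1 / 2 < x i t. velocity a t z i)) (at t)"
proof -
  have "((\<lambda>s. max 0 (x i s - (of_int h - 1 / 2))) has_real_derivative
      (if x i t > of_int h - 1 / 2 then velocity a t z i else 0)) (at t)" for i
  proof (rule has_real_derivative_positive_part)
    show "(x i has_real_derivative velocity a t z i) (at t)"
      using sel unfolding selection_at_def by blast
    assume "x i t = of_int h - 1 / 2"
    then have "x i t = of_int (h - 1) + 1 / 2" by simp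
    then show "velocity a t z i = 0" using sel unfolding selection_at_def by blast
  qed
  then have "((\<lambda>s. \<Sum>i\<in>UNIV. max 0 (x i s - (of_int h - 1 / 2))) has_real_derivative
      (\<Sum>i\<in>UNIV. if x i t > of_int h - 1 / 2 then velocity a t z i else 0)) (at t)"
    by (intro DERIV_sum)
  moreover have "(\<Sum>i\<in>UNIV. if x i t > of_int h - 1 / 2 then velocity a t z i else 0) =
      (\<Sum>i | of_int h - 1 / 2 < x i t. velocity a t z i)"
    by (subst sum.inter_filter[symmetric]) auto
  ultimately show ?thesis unfolding upper_excess_def[abs_def] by simp
qed


section \<open>Emptying an extreme level\<close>

text \<open>
  The total height of \<open>N\<close> agents in one level is at most \<open>N\<close>; this is the time needed to remove it at the
  guaranteed speed.
\<close>

definition phase_time :: real where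
  "phase_time = real CARD('n) / decay_rate"

lemma phase_time_nonneg: "0 \<le> phase_time"
  unfolding phase_time_def using decay_rate_pos by simp

lemma reachable_closed: "j \<in> {j. (r, j) \<in> E\<^sup>*} \<Longrightarrow> (j, k) \<in> E \<Longrightarrow> k \<in> {j. (r, j) \<in> E\<^sup>*}"
  by (auto intro: rtrancl_into_rtrancl)

lemma upper_level_occupied_before:
  assumes "0 \<le> s" "s \<le> t" and "of_int h - 1 / 2 < x i t"
  shows "\<exists>k. of_int h - 1 / 2 < x k s"
proof (rule ccontr)
  assume "\<not> ?thesis"
  then show False
    using upper_bound_invariant[OF assms(1,2), of UNIV "of_int h - 1 / 2" i] assms(3)
    by (auto simp: not_less)
qed

text \<open>
  With everything reachable from \<open>r\<close> below the top two levels, \<open>z\<^sub>r\<close> is at most \<open>h - 1\<close> at all later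
  times, so the top level loses height at the guaranteed speed as long as it is occupied.
\<close>

lemma upper_level_emptied:
  assumes "0 \<le> s" and root: "\<And>i. (i, r) \<in> E\<^sup>*"
    and below: "\<And>i. x i s \<le> of_int h + 1 / 2"
    and low: "\<And>j. (r, j) \<in> E\<^sup>* \<Longrightarrow> x j s \<le> of_int h - 3 / 2"
  shows "x i (s + phase_time) \<le> of_int h - 1 / 2"
proof (rule ccontr)
  assume "\<not> ?thesis"
  then have i: "of_int h - 1 / 2 < x i (s + phase_time)" by simp
  let ?t = "s + phase_time"
  have "upper_excess x h ?t - upper_excess x h s \<le> - decay_rate * (?t - s)"
  proof (rule growth_bound[where C = 1])
    show "\<bar>upper_excess x h v - upper_excess x h u\<bar> \<le> 1 * (\<Sum>i\<in>UNIV. \<bar>x i v - x i u\<bar>)" for u v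
      using upper_excess_lipschitz by simp
    fix \<tau> z assume \<tau>: "s < \<tau>" "\<tau> < ?t" and sel: "selection_at a x \<tau> z"
    have below': "x k \<tau> \<le> of_int h + 1 / 2" for k
      using upper_bound_invariant[of s \<tau> UNIV] below \<open>0 \<le> s\<close> \<tau> by simp
    have "x r \<tau> \<le> of_int h - 3 / 2"
      using upper_bound_invariant[of s \<tau> "{j. (r, j) \<in> E\<^sup>*}"] reachable_closed low \<open>0 \<le> s\<close> \<tau> by simp
    then have "x r \<tau> < of_int (h - 1) + 1 / 2" by simp
    then have "z r \<le> of_int (h - 1)"
      using sel unfolding selection_at_def unit_krasovskii_def by blast
    moreover have "z k \<le> of_int h" for k
      by (rule selection_le_level[OF sel below' root, of r])
        (use \<open>x r \<tau> \<le> of_int h - 3 / 2\<close> in auto)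
    moreover obtain k where "of_int h - 1 / 2 < x k \<tau>"
      using upper_level_occupied_before[OF _ _ i, of \<tau>] \<open>0 \<le> s\<close> \<tau> by auto
    ultimately have "(\<Sum>i | of_int h - 1 / 2 < x i \<tau>. velocity a \<tau> z i) \<le> - decay_rate"
      using upper_velocity_decay[OF sel _ root] by simp
    then show "secant_bound (upper_excess x h) (- decay_rate) \<tau>"
      by (rule secant_bound_if_derivative[OF upper_excess_derivative[OF sel]])
  qed (use \<open>0 \<le> s\<close> phase_time_nonneg in auto)
  moreover have "upper_excess x h s \<le> real CARD('n) * 1"
  proof -
    have "max 0 (x i s - (of_int h - 1 / 2)) \<le> 1" for i using below[of i] by simp
    then show ?thesis unfolding upper_excess_def by (intro sum_bounded_above) auto
  qed
  moreover have "decay_rate * phase_time = real CARD('n)"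
    unfolding phase_time_def using decay_rate_pos by simp
  ultimately show False using upper_excess_pos[of h x i, OF i] by simp
qed

lemma lower_level_emptied:
  assumes "0 \<le> s" and "\<And>i. (i, r) \<in> E\<^sup>*" and "\<And>i. of_int l - 1 / 2 \<le> x i s"
    and "\<And>j. (r, j) \<in> E\<^sup>* \<Longrightarrow> of_int l + 3 / 2 \<le> x j s"
  shows "of_int l + 1 / 2 \<le> x i (s + phase_time)"
proof -
  have "- x i (s + phase_time) \<le> of_int (- l) - 1 / 2"
  proof (rule quantized_flow.upper_level_emptied[OF uminus_flow])
    show "- x i s \<le> of_int (- l) + 1 / 2" for i using assms(3)[of i] by simp
    show "- x j s \<le> of_int (- l) - 3 / 2" if "(r, j) \<in> E\<^sup>*" for j using assms(4)[OF that] by simp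
  qed (use assms in auto)
  then show ?thesis by simp
qed

text \<open>
  As long as the agents reachable from \<open>r\<close> are not all at the same end of the interval, all quantized values
  stay in \<open>[l, h]\<close>, so neither excess grows and one of them shrinks at the guaranteed speed. It suffices to
  exclude this at the final time, because a configuration with all these agents at one end persists.
\<close>

lemma extreme_level_emptied:
  assumes "0 \<le> s" and "l < h" and root: "\<And>i. (i, r) \<in> E\<^sup>*"
    and bounds: "\<And>i. of_int l - 1 / 2 \<le> x i s" "\<And>i. x i s \<le> of_int h + 1 / 2"
    and not_top: "\<exists>j. (r, j) \<in> E\<^sup>* \<and> x j (s + phase_time) \<noteq> of_int h + 1 / 2"
    and not_bottom: "\<exists>j. (r, j) \<in> E\<^sup>* \<and> x j (s + phase_time) \<noteq> of_int l - 1 / 2"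
  shows "(\<forall>i. x i (s + phase_time) \<le> of_int h - 1 / 2) \<or> (\<forall>i. of_int l + 1 / 2 \<le> x i (s + phase_time))"
proof (rule ccontr)
  let ?t = "s + phase_time"
  let ?y = "\<lambda>i t. - x i t"
  assume "\<not> ?thesis"
  then obtain i k where i: "of_int h - 1 / 2 < x i ?t" and k: "x k ?t < of_int l + 1 / 2"
    by (auto simp: not_le)
  then have k': "of_int (- l) - 1 / 2 < ?y k ?t" by simp
  have "0 \<le> phase_time" by (rule phase_time_nonneg)
  define V where "V t = upper_excess x h t + upper_excess ?y (- l) t" for t
  have "V ?t - V s \<le> - decay_rate * (?t - s)"
  proof (rule growth_bound[where C = 2])
    show "\<bar>V v - V u\<bar> \<le> 2 * (\<Sum>i\<in>UNIV. \<bar>x i v - x i u\<bar>)" for u v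
      using upper_excess_lipschitz[of x h v u] upper_excess_lipschitz[of ?y "- l" v u]
      unfolding V_def by (simp add: abs_minus_commute)
    fix \<tau> z assume \<tau>: "s < \<tau>" "\<tau> < ?t" and sel: "selection_at a x \<tau> z"
    note sel' = selection_at_uminus[OF sel]
    have upper: "x j \<tau>' \<le> of_int h + 1 / 2" if "s \<le> \<tau>'" for j \<tau>'
      using upper_bound_invariant[of s \<tau>' UNIV] bounds(2) \<open>0 \<le> s\<close> that by simp
    have lower: "of_int l - 1 / 2 \<le> x j \<tau>'" if "s \<le> \<tau>'" for j \<tau>'
      using lower_bound_invariant[of s \<tau>' UNIV] bounds(1) \<open>0 \<le> s\<close> that by simp
    have z_le: "z j \<le> of_int h" for j
    proof -
      have "\<exists>j. (r, j) \<in> E\<^sup>* \<and> x j \<tau> \<noteq> of_int h + 1 / 2"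
      proof (rule ccontr)
        assume top: "\<not> ?thesis"
        have "x j ?t = of_int h + 1 / 2" if "(r, j) \<in> E\<^sup>*" for j
          using lower_bound_invariant[of \<tau> ?t "{j. (r, j) \<in> E\<^sup>*}" "of_int h + 1 / 2" j]
            reachable_closed top that \<open>0 \<le> s\<close> \<tau> upper[of ?t j] \<open>0 \<le> phase_time\<close> by force
        then show False using not_top by blast
      qed
      then show ?thesis using selection_le_level[OF sel upper root] \<tau> by force
    qed
    have z_ge: "- z j \<le> of_int (- l)" for j
    proof -
      have "\<exists>j. (r, j) \<in> E\<^sup>* \<and> x j \<tau> \<noteq> of_int l - 1 / 2"
      proof (rule ccontr)
        assume bottom: "\<not> ?thesis"
        have "x j ?t = of_int l - 1 / 2" if "(r, j) \<in> E\<^sup>*" for j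
          using upper_bound_invariant[of \<tau> ?t "{j. (r, j) \<in> E\<^sup>*}" "of_int l - 1 / 2" j]
            reachable_closed bottom that \<open>0 \<le> s\<close> \<tau> lower[of ?t j] \<open>0 \<le> phase_time\<close> by force
        then show False using not_bottom by blast
      qed
      then obtain j' where j': "(r, j') \<in> E\<^sup>*" "- x j' \<tau> \<noteq> of_int (- l) + 1 / 2" by force
      show ?thesis
      proof (rule quantized_flow.selection_le_level[OF uminus_flow sel' _ root j'])
        show "- x i \<tau> \<le> of_int (- l) + 1 / 2" for i using lower[of \<tau> i] \<tau> by simp
      qed
    qed
    let ?D1 = "\<Sum>i | of_int h - 1 / 2 < x i \<tau>. velocity a \<tau> z i"
    let ?D2 = "\<Sum>i | of_int (- l) - 1 / 2 < - x i \<tau>. velocity a \<tau> (\<lambda>i. - z i) i"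
    have D1: "?D1 \<le> 0"
      using upper_velocity_nonpos[OF sel z_le] by (intro sum_nonpos) auto
    have D2: "?D2 \<le> 0"
      using quantized_flow.upper_velocity_nonpos[OF uminus_flow sel' z_ge] by (intro sum_nonpos) auto
    \<comment> \<open>As \<open>h - l \<ge> 1\<close>, the value of \<open>r\<close> is half a step away from \<open>h\<close> or from \<open>l\<close>.\<close>
    have "?D1 + ?D2 \<le> - decay_rate"
    proof (cases "z r \<le> of_int h - 1 / 2")
      case True
      obtain i' where "of_int h - 1 / 2 < x i' \<tau>"
        using upper_level_occupied_before[OF _ _ i, of \<tau>] \<open>0 \<le> s\<close> \<tau> by auto
      from upper_velocity_decay[OF sel z_le root True this] D2 show ?thesis by simp
    next
      case False
      have "- z r \<le> of_int (- l) - 1 / 2"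
      proof -
        have "of_int (l + 1) \<le> (of_int h :: real)" using \<open>l < h\<close> by (subst of_int_le_iff) simp
        then show ?thesis using False by simp
      qed
      moreover obtain k' where "of_int (- l) - 1 / 2 < - x k' \<tau>"
        using quantized_flow.upper_level_occupied_before[OF uminus_flow _ _ k', of \<tau>] \<open>0 \<le> s\<close> \<tau> by auto
      ultimately have "?D2 \<le> - decay_rate"
        by (rule quantized_flow.upper_velocity_decay[OF uminus_flow sel' z_ge root])
      then show ?thesis using D1 by linarith
    qed
    moreover have "(V has_real_derivative ?D1 + ?D2) (at \<tau>)"
      unfolding V_def[abs_def]
      by (intro DERIV_add upper_excess_derivative[OF sel]
          quantized_flow.upper_excess_derivative[OF uminus_flow sel'])
    ultimately show "secant_bound V (- decay_rate) \<tau>"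
      by (intro secant_bound_if_derivative)
  qed (use \<open>0 \<le> s\<close> \<open>0 \<le> phase_time\<close> in auto)
  moreover have "V s \<le> real CARD('n) * 1"
  proof -
    have "of_int (l + 1) \<le> (of_int h :: real)" using \<open>l < h\<close> by (subst of_int_le_iff) simp
    then have "max 0 (x i s - (of_int h - 1 / 2)) + max 0 (?y i s - (of_int (- l) - 1 / 2)) \<le> 1" for i
      using bounds[of i] by (auto simp: max_def)
    then show ?thesis
      unfolding V_def upper_excess_def sum.distrib[symmetric] by (intro sum_bounded_above) auto
  qed
  moreover have "decay_rate * phase_time = real CARD('n)"
    unfolding phase_time_def using decay_rate_pos by simp
  moreover have "0 < V ?t"
    unfolding V_def using upper_excess_pos[of h x i, OF i] upper_excess_nonneg[of ?y "- l" ?t] by simp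
  ultimately show False by simp
qed

text \<open>
  The state after one phase decides: if the agents reachable from \<open>r\<close> are all at one end of the interval, the
  opposite extreme level empties during the second phase, and otherwise one extreme level is already empty.
\<close>

lemma spread_decreases:
  assumes "0 \<le> s" and "l < h" and root: "\<And>i. (i, r) \<in> E\<^sup>*"
    and bounds: "\<And>i. of_int l - 1 / 2 \<le> x i s" "\<And>i. x i s \<le> of_int h + 1 / 2"
  shows "(\<forall>i. x i (s + 2 * phase_time) \<le> of_int h - 1 / 2) \<or> (\<forall>i. of_int l + 1 / 2 \<le> x i (s + 2 * phase_time))"
proof -
  let ?m = "s + phase_time"
  have t: "0 \<le> ?m" "s \<le> ?m" "?m \<le> s + 2 * phase_time" "s + 2 * phase_time = ?m + phase_time"
    using \<open>0 \<le> s\<close> phase_time_nonneg by auto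
  have lh: "of_int l + 1 \<le> (of_int h :: real)"
    using \<open>l < h\<close> by (metis of_int_1 of_int_add of_int_le_iff zless_imp_add1_zle)
  have upper: "x j ?m \<le> of_int h + 1 / 2" for j
    using upper_bound_invariant[of s ?m UNIV] bounds(2) \<open>0 \<le> s\<close> t by simp
  have lower: "of_int l - 1 / 2 \<le> x j ?m" for j
    using lower_bound_invariant[of s ?m UNIV] bounds(1) \<open>0 \<le> s\<close> t by simp
  consider (bottom) "\<forall>j. (r, j) \<in> E\<^sup>* \<longrightarrow> x j ?m = of_int l - 1 / 2"
    | (top) "\<forall>j. (r, j) \<in> E\<^sup>* \<longrightarrow> x j ?m = of_int h + 1 / 2"
    | (neither) "\<exists>j. (r, j) \<in> E\<^sup>* \<and> x j ?m \<noteq> of_int h + 1 / 2"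
        "\<exists>j. (r, j) \<in> E\<^sup>* \<and> x j ?m \<noteq> of_int l - 1 / 2"
    by blast
  then show ?thesis
  proof cases
    case bottom
    have "x i (?m + phase_time) \<le> of_int h - 1 / 2" for i
      by (rule upper_level_emptied[OF t(1) root upper]) (use bottom lh in auto)
    then show ?thesis by (simp add: t(4))
  next
    case top
    have "of_int l + 1 / 2 \<le> x i (?m + phase_time)" for i
      by (rule lower_level_emptied[OF t(1) root lower]) (use top lh in auto)
    then show ?thesis by (simp add: t(4))
  next
    case neither
    from extreme_level_emptied[OF \<open>0 \<le> s\<close> \<open>l < h\<close> root bounds this] show ?thesis
    proof
      assume "\<forall>i. x i ?m \<le> of_int h - 1 / 2"
      then show ?thesis
        using upper_bound_invariant[OF t(1,3), of UNIV "of_int h - 1 / 2"] by blast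
    next
      assume "\<forall>i. of_int l + 1 / 2 \<le> x i ?m"
      then show ?thesis
        using lower_bound_invariant[OF t(1,3), of UNIV "of_int l + 1 / 2"] by blast
    qed
  qed
qed

lemma reaches_consensus:
  assumes "0 \<le> s" and root: "\<And>i. (i, r) \<in> E\<^sup>*"
    and "\<And>i. of_int l - 1 / 2 \<le> x i s" "\<And>i. x i s \<le> of_int (l + int m) + 1 / 2"
  shows "\<exists>k::int. \<forall>t\<ge>s + real m * (2 * phase_time). \<forall>i. x i t \<in> {of_int k - 1 / 2..of_int k + 1 / 2}"
  using assms(1,3,4)
proof (induction m arbitrary: s l)
  case 0
  have "of_int l - 1 / 2 \<le> x i t \<and> x i t \<le> of_int l + 1 / 2" if "s \<le> t" for i t
    using upper_bound_invariant[of s t UNIV "of_int l + 1 / 2" i]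
      lower_bound_invariant[of s t UNIV "of_int l - 1 / 2" i] 0 that by simp
  then show ?case by (intro exI[of _ l]) simp
next
  case (Suc m)
  let ?t = "s + 2 * phase_time"
  have t: "0 \<le> ?t" "s \<le> ?t" using Suc.prems phase_time_nonneg by auto
  have "x i ?t \<le> of_int (l + int (Suc m)) + 1 / 2" "of_int l - 1 / 2 \<le> x i ?t" for i
    using upper_bound_invariant[of s ?t UNIV _ i] lower_bound_invariant[of s ?t UNIV _ i]
      Suc.prems t by auto
  moreover from spread_decreases[OF Suc.prems(1) _ root Suc.prems(2,3)]
  have "(\<forall>i. x i ?t \<le> of_int (l + int (Suc m)) - 1 / 2) \<or> (\<forall>i. of_int l + 1 / 2 \<le> x i ?t)"
    by simp
  ultimately have "\<exists>l'. \<forall>i. of_int l' - 1 / 2 \<le> x i ?t \<and> x i ?t \<le> of_int (l' + int m) + 1 / 2"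
    by (elim disjE; intro exI[of _ l] exI[of _ "l + 1"]) (auto simp: algebra_simps)
  then obtain l' where l': "\<And>i. of_int l' - 1 / 2 \<le> x i ?t" "\<And>i. x i ?t \<le> of_int (l' + int m) + 1 / 2"
    by blast
  from Suc.IH[OF t(1) l'] show ?case by (simp add: algebra_simps)
qed

text \<open>
  Two phases cost \<open>4 N / (a_min \<kappa>^(N-2))\<close>, and \<open>4 \<le> 1 / \<kappa>\<^sup>2\<close> for at least two agents.
\<close>

lemma phase_time_le:
  assumes "2 \<le> CARD('n)"
  shows "2 * phase_time \<le> real CARD('n) / a_min * (real CARD('n) * a_max / a_min) ^ CARD('n)"
proof -
  define K where "K = real CARD('n) * a_max / a_min"
  have "2 * 1 \<le> real CARD('n) * (a_max / a_min)"
    using assms a_min_pos a_min_le by (intro mult_mono) auto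
  then have "2 \<le> K" by (simp add: K_def)
  have att: "attenuation = 1 / K"
    unfolding attenuation_def K_def by simp
  have "2 * phase_time = real CARD('n) / a_min * (4 * K ^ (CARD('n) - 2))"
    unfolding phase_time_def decay_rate_def att using a_min_pos \<open>2 \<le> K\<close>
    by (simp add: power_divide field_simps)
  also have "\<dots> \<le> real CARD('n) / a_min * (K ^ 2 * K ^ (CARD('n) - 2))"
    using \<open>2 \<le> K\<close> a_min_pos power_mono[of 2 K 2] by (intro mult_left_mono mult_right_mono) auto
  also have "K ^ 2 * K ^ (CARD('n) - 2) = K ^ CARD('n)"
    using assms by (metis le_add_diff_inverse power_add)
  finally show ?thesis unfolding K_def .
qed

end


section \<open>Consensus of the Krasovskii solutions\<close>

theorem proposition4:
  fixes a :: "'n::finite \<Rightarrow> 'n \<Rightarrow> real \<Rightarrow> real"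
    and a_min a_max \<Delta> :: real
    and q :: "real \<Rightarrow> real"
    and x :: "real \<Rightarrow> real ^ 'n"
  assumes "0 < a_min" and "a_min \<le> a_max"
    and "\<And>i j. a i j \<in> borel_measurable (lebesgue_on {0..})"
    and "\<And>i j t. t \<ge> 0 \<Longrightarrow> a i j t \<in> {0} \<union> {a_min..a_max}"
    and "\<And>i t. t \<ge> 0 \<Longrightarrow> a i i t = 0"
    and time_invariant:
      "\<And>i j. (\<forall>t\<ge>0. a i j t = 0) \<or> (\<forall>t\<ge>0. a i j t \<in> {a_min..a_max})"
    and "\<Delta> > 0"
    and "q = uniform_quantizer \<Delta>"
    and "complete_krasovskii_solution (quantized_consensus a q) x"
    and "unilaterally_connected (with_proj (condensation (with_proj (limit_graph a))))"
    and "\<exists>!V. is_sink (with_proj (condensation (with_proj (limit_graph a)))) V"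
  shows "\<exists>T_con q_inf. T_con \<ge> 0 \<and> q_inf \<in> multiples \<Delta> \<and>
    (\<forall>t\<ge>T_con. \<forall>i. x t $ i \<in> {q_inf - \<Delta> / 2..q_inf + \<Delta> / 2}) \<and>
    T_con \<le> 1 / \<Delta> * (real CARD('n) / a_min) * (real CARD('n) * a_max / a_min) ^ CARD('n) *
      Max {\<bar>q (x 0 $ i) - q (x 0 $ j)\<bar> | i j. True}"
proof -
  define E where "E = parcs (limit_graph a)"
  define y where "y i t = x t $ i / \<Delta>" for i t
  have sol: "\<And>s t. {s..t} \<subseteq> {0<..} \<Longrightarrow> absolutely_continuous_on {s..t} x"
    "AE t\<in>{0<..} in lebesgue. \<exists>v. (x has_vector_derivative v) (at t within {0<..}) \<and>
      v \<in> krasovskii (quantized_consensus a (uniform_quantizer \<Delta>) t) (x t)"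
    "continuous (at_right 0) x"
    using assms(9) unfolding complete_krasovskii_solution_def krasovskii_solution_def \<open>q = _\<close> by auto
  interpret quantized_flow a E a_min a_max y
  proof
    show "0 < a_min" "a_min \<le> a_max" by fact+
    fix i j
    show "a i j t \<in> {a_min..a_max}" if "(i, j) \<in> E" "0 \<le> t" for t
      using time_invariant[of i j] that unfolding E_def limit_graph_def by force
    show "a i j t = 0" if "(i, j) \<notin> E" "0 \<le> t" for t
      using time_invariant[of i j] that \<open>0 < a_min\<close> unfolding E_def limit_graph_def by force
    show "absolutely_continuous_on {s..t} (y i)" if "0 < s" for s t
    proof (rule absolutely_continuous_on_dominated[where I = "{()}" and g = "\<lambda>_. x" and C = "1 / \<Delta>"])
      show "absolutely_continuous_on {s..t} x" using that by (intro sol(1)) auto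
      show "norm (y i v - y i u) \<le> 1 / \<Delta> * (\<Sum>_\<in>{()}. norm (x v - x u))" for u v
        using component_le_norm_cart[of "x v - x u" i] \<open>\<Delta> > 0\<close>
        by (simp add: y_def abs_divide divide_right_mono flip: diff_divide_distrib)
    qed auto
    have "(x \<longlongrightarrow> x 0) (at_right 0)" using sol(3) by (simp add: continuous_within)
    then show "(y i \<longlongrightarrow> y i 0) (at_right 0)"
      unfolding y_def using \<open>\<Delta> > 0\<close> by (auto intro!: tendsto_intros)
  next
    show "AE t in lebesgue. 0 < t \<longrightarrow> (\<exists>z. (\<forall>i. unit_krasovskii (y i t) (z i)) \<and>
        (\<forall>i. (y i has_real_derivative velocity a t z i) (at t)))"
      using sol(2)
    proof eventually_elim
      case (elim t)
      show ?case
      proof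
        assume "0 < t"
        then obtain v where v: "(x has_vector_derivative v) (at t)"
          "v \<in> krasovskii (quantized_consensus a (uniform_quantizer \<Delta>) t) (x t)"
          using elim by (auto simp: at_within_open[of t "{0<..}"])
        obtain z where z: "\<forall>i. unit_krasovskii (x t $ i / \<Delta>) (z i)"
          "\<forall>i. v $ i / \<Delta> = (\<Sum>j\<in>UNIV. a i j t * (z j - z i))"
          using krasovskii_quantized_consensus[OF \<open>\<Delta> > 0\<close> v(2)] by blast
        have "(y i has_real_derivative velocity a t z i) (at t)" for i
        proof -
          have "((\<lambda>t. x t $ i) has_vector_derivative v $ i) (at t)"
            by (rule bounded_linear.has_vector_derivative[OF bounded_linear_vec_nth v(1)])
          then have "((\<lambda>t. x t $ i) has_real_derivative v $ i) (at t)"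
            by (simp add: has_real_derivative_iff_has_vector_derivative)
          then have "(y i has_real_derivative v $ i / \<Delta>) (at t)"
            unfolding y_def[abs_def] by (rule DERIV_cdivide)
          then show ?thesis using z(2) by (simp add: velocity_def)
        qed
        then show "\<exists>z. (\<forall>i. unit_krasovskii (y i t) (z i)) \<and>
            (\<forall>i. (y i has_real_derivative velocity a t z i) (at t))"
          using z(1) by (auto simp: y_def)
      qed
    qed
  qed
  obtain V where "is_sink (with_proj (condensation (with_proj (limit_graph a)))) V"
    using assms(11) by (elim ex1E)
  then obtain r where root: "\<And>i. (i, r) \<in> E\<^sup>*"
    using exists_globally_reachable_node[OF assms(10)] unfolding E_def by metis
  \<comment> \<open>The initial spread of the quantized states is \<open>m\<close> steps, each of which costs two phases.\<close>
  define level where "level i = \<lfloor>y i 0 + 1 / 2\<rfloor>" for i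
  define l where "l = Min (range level)"
  define h where "h = Max (range level)"
  define m where "m = nat (h - l)"
  have "l \<in> range level" "h \<in> range level" unfolding l_def h_def by (auto intro!: Min_in Max_in)
  then obtain i_l i_h where attained: "l = level i_l" "h = level i_h" by auto
  have lh: "l \<le> level i" "level i \<le> h" for i unfolding l_def h_def by auto
  have m: "h = l + int m" using lh[of i_l] by (simp add: m_def)
  have start: "of_int l - 1 / 2 \<le> y i 0 \<and> y i 0 \<le> of_int (l + int m) + 1 / 2" for i
  proof -
    have "of_int l \<le> (of_int (level i) :: real)" "of_int (level i) \<le> (of_int h :: real)"
      using lh by (auto simp: of_int_le_iff)
    moreover have "of_int (level i) \<le> y i 0 + 1 / 2" "y i 0 + 1 / 2 < of_int (level i) + 1"
      unfolding level_def by linarith+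
    ultimately show ?thesis using m by simp
  qed
  obtain k :: int where k: "\<forall>t\<ge>0 + real m * (2 * phase_time). \<forall>i. y i t \<in> {of_int k - 1 / 2..of_int k + 1 / 2}"
    using reaches_consensus[of 0 r l m] root start by auto
  define T where "T = real m * (2 * phase_time)"
  define D where "D = Max {\<bar>q (x 0 $ i) - q (x 0 $ j)\<bar> | i j. True}"
  have q_level: "q (x 0 $ i) = of_int (level i) * \<Delta>" for i
    by (simp add: \<open>q = _\<close> uniform_quantizer_def level_def y_def)
  have D: "real m * \<Delta> \<le> D"
  proof -
    have "{\<bar>q (x 0 $ i) - q (x 0 $ j)\<bar> | i j. True} = (\<lambda>(i, j). \<bar>q (x 0 $ i) - q (x 0 $ j)\<bar>) ` UNIV" by auto
    then have "finite {\<bar>q (x 0 $ i) - q (x 0 $ j)\<bar> | i j. True}" by simp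
    then have "\<bar>q (x 0 $ i_h) - q (x 0 $ i_l)\<bar> \<le> D" unfolding D_def by (rule Max_ge) blast
    moreover have "q (x 0 $ i_h) - q (x 0 $ i_l) = real m * \<Delta>"
      using m by (simp add: q_level flip: attained) (simp add: algebra_simps)
    ultimately show ?thesis by linarith
  qed
  let ?C = "real CARD('n) / a_min * (real CARD('n) * a_max / a_min) ^ CARD('n)"
  have "0 \<le> ?C" using \<open>0 < a_min\<close> \<open>a_min \<le> a_max\<close> by simp
  have "T \<le> real m * ?C"
  proof (cases "m = 0")
    case False
    then have "i_l \<noteq> i_h" using attained m by auto
    then have "card {i_l, i_h} = 2" by simp
    moreover have "card {i_l, i_h} \<le> CARD('n)" by (intro card_mono) auto
    ultimately show ?thesis unfolding T_def by (intro mult_left_mono phase_time_le) auto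
  qed (simp add: T_def)
  also have "\<dots> \<le> D / \<Delta> * ?C"
    using D \<open>\<Delta> > 0\<close> \<open>0 \<le> ?C\<close> by (intro mult_right_mono) (auto simp: field_simps)
  finally have bound: "T \<le> 1 / \<Delta> * (real CARD('n) / a_min) * (real CARD('n) * a_max / a_min) ^ CARD('n) * D"
    by (simp add: mult_ac)
  have "x t $ i \<in> {of_int k * \<Delta> - \<Delta> / 2..of_int k * \<Delta> + \<Delta> / 2}" if "T \<le> t" for t i
    using k that \<open>\<Delta> > 0\<close> by (auto simp: T_def y_def field_simps)
  moreover have "of_int k * \<Delta> \<in> multiples \<Delta>" unfolding multiples_def by (rule rangeI)
  moreover have "0 \<le> T" unfolding T_def using phase_time_nonneg by simp
  ultimately show ?thesis using bound unfolding D_def by blast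
qed

end
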